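(* Let $E=[n]\cup[n]^*$ and let $F$ be a tract endowed with an involution $x\mapsto\overline{x}$. Then there is a natural bijection between: (1) moderately weak orthogonal $F$-matroids on $E$; (2) weak orthogonal $F$-signatures on $E$.
   Context: **Tracts.** A tract $F=(G,N_F)$ is an abelian group $G$ (written multiplicatively) with a subset $N_F$ of the group semiring $\mathbb{N}[G]$ such that: $0\in N_F$; $1\notin N_F$; there is a unique $\epsilon\in G$ with $1+\epsilon\in N_F$; and $g\in G$, $a\in N_F$ imply $ga\in N_F$. Write $F$ also for the set $G\cup\{0\}$ (with $0\cdot x=0$), $F^\times=G$, $-1:=\epsilon$, $-x:=\epsilon x$. Formal sums of elements of $F$ are regarded as elements of $\mathbb{N}[G]$ ($0\in F$ being the zero of $\mathbb{N}[G]$). A tract homomorphism $F_1\to F_2$ is a group homomorphism $F_1^\times\to F_2^\times$ (extended by $0\mapsto 0$) whose induced map $\mathbb{N}[F_1^\times]\to\mathbb{N}[F_2^\times]$ sends $N_{F_1}$ into $N_{F_2}$. An involution of $F$ is a tract homomorphism $F\to F$ whose square is the identity. **Orthogonal matroids.** $E=[n]\cup[n]^*=\{1,\dots,n\}\cup\{1^*,\dots,n^*\}$ with the involution $*$ exchanging $i$ and $i^*$. For $A\subseteq E$ let $A^*=\{a^*:a\in A\}$. $A$ is admissible if $A\cap A^*=\emptyset$; a transversal is an admissible set with $n$ elements; $\mathcal{T}_n$ is the set of transversals. $\triangle$ is symmetric difference. An orthogonal matroid on $E$ is a pair $\underline{M}=(E,\mathcal{B})$ with $\mathcal{B}$ a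 nonempty set of transversals (bases) such that for $B_1,B_2\in\mathcal{B}$ and every $\{x_1,x_1^*\}\subseteq B_1\triangle B_2$ there is $\{x_2,x_2^*\}\subseteq B_1\triangle B_2$ with $\{x_2,x_2^*\}\neq\{x_1,x_1^*\}$ and $B_1\triangle\{x_1,x_1^*,x_2,x_2^*\}\in\mathcal{B}$. A circuit is an inclusion-minimal admissible subset of $E$ not contained in a basis. **Moderately weak orthogonal $F$-matroids.** A moderately weak Wick function on $E$ with coefficients in $F$ is a map $\varphi:\mathcal{T}_n\to F$, not identically zero, whose support $\{T:\varphi(T)\neq0\}$ is the set of bases of an orthogonal matroid on $E$, such that for all $T_1,T_2\in\mathcal{T}_n$, writing $(T_1\triangle T_2)\cap[n]=\{x_1<\dots<x_m\}$, if at most four of the products $\varphi(T_1\triangle\{x_k,x_k^*\})\varphi(T_2\triangle\{x_k,x_k^*\})$ are nonzero then $\sum_{k=1}^m(-1)^k\varphi(T_1\triangle\{x_k,x_k^*\})\varphi(T_2\triangle\{x_k,x_k^*\})\in N_F$. Two such functions are equivalent if one is a multiple of the other by an element of $F^\times$; an equivalence class $[\varphi]$ is a moderately weak orthogonal $F$-matroid. **Signatures.** For $X\in F^E$: $\underline{X}=\{i\in E:X(i)\neq0\}$ is the support; $X^*(i)=X(i^* )$; and for $\alpha\in F$, $\alpha X$ is coordinatewise multiplication by $\alpha$. The inner product is $\langle X,Y\rangle=\sum_{i\in[n]}(X(i)\overline{Y(i)}+\overline{X(i^* )}Y(i^* ))$. An $F$-signature of an orthogonal matroid $\underline{M}$ on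 $E$ is a set $\mathcal{C}\subseteq F^E$ such that $\{\underline{X}:X\in\mathcal{C}\}$ is the set of circuits of $\underline{M}$ and $\alpha X\in\mathcal{C}$ for all $X\in\mathcal{C}$, $\alpha\in F^\times$. It is a weak orthogonal $F$-signature of $\underline{M}$ if $\langle X,Y^*\rangle\in N_F$ for all $X,Y\in\mathcal{C}$ with $|\underline{X}\cap\underline{Y}^*|\leq4$. A weak orthogonal $F$-signature on $E$ is a weak orthogonal $F$-signature of some orthogonal matroid on $E$.
   Formalization: The scalar multiple αX multiplies coordinates in [n] by α and those in [n]* by the conjugate of α, instead of by α everywhere; with plain coordinatewise scaling the claim fails for nontrivial involutions (e.g. F_4 with Frobenius, n=2: 10 matroids but 7 signatures). *)

theory Defs
  imports "HOL-Algebra.Group" "HOL-Library.Multiset"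
begin

section \<open>Tracts\<close>

text \<open>
  The group semiring of formal sums of group elements with natural number coefficients is
  represented additively by finite multisets; a group element acts on it by
  \<^term>\<open>image_mset\<close>.
\<close>

record 'a tract = "'a monoid" +
  null_set :: "'a multiset set"

locale tract = comm_group F for F (structure) +
  assumes null_set_carrier: "a \<in> null_set F \<Longrightarrow> set_mset a \<subseteq> carrier F"
    and zero_null: "{#} \<in> null_set F"
    and one_not_null: "{#\<one>#} \<notin> null_set F"
    and unique_neg_one: "\<exists>!e. e \<in> carrier F \<and> {#\<one>, e#} \<in> null_set F"
    and null_set_scale:
      "g \<in> carrier F \<Longrightarrow> a \<in> null_set F \<Longrightarrow> image_mset (\<lambda>x. g \<otimes> x) a \<in> null_set F"

definition neg_one :: "('a, 'm) tract_scheme \<Rightarrow> 'a" where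
  "neg_one F = (THE e. e \<in> carrier F \<and> {#\<one>\<^bsub>F\<^esub>, e#} \<in> null_set F)"

text \<open>
  The set obtained from the unit group by adjoining 0 is modelled by the option type: the
  zero is \<^term>\<open>None\<close>, and a unit \<open>g\<close> is \<open>Some g\<close>.
\<close>

definition elts :: "('a, 'm) tract_scheme \<Rightarrow> 'a option set" where
  "elts F = insert None (Some ` carrier F)"

fun tmult :: "('a, 'm) tract_scheme \<Rightarrow> 'a option \<Rightarrow> 'a option \<Rightarrow> 'a option" where
  "tmult F (Some x) (Some y) = Some (x \<otimes>\<^bsub>F\<^esub> y)"
| "tmult F None y = None"
| "tmult F x None = None"

definition alt_sign :: "('a, 'm) tract_scheme \<Rightarrow> nat \<Rightarrow> 'a option \<Rightarrow> 'a option" where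
  "alt_sign F k x = tmult F (Some (neg_one F [^]\<^bsub>F\<^esub> k)) x"
  \<comment> \<open>\<open>(-1)\<^sup>k x\<close>\<close>

fun formal :: "'a option \<Rightarrow> 'a multiset" where
  "formal None = {#}"
| "formal (Some g) = {#g#}"

definition tract_hom :: "('a, 'm) tract_scheme \<Rightarrow> ('b, 'k) tract_scheme \<Rightarrow> ('a \<Rightarrow> 'b) set" where
  "tract_hom F K = {h \<in> hom F K. \<forall>a \<in> null_set F. image_mset h a \<in> null_set K}"

definition tract_involution :: "('a, 'm) tract_scheme \<Rightarrow> ('a \<Rightarrow> 'a) \<Rightarrow> bool" where
  "tract_involution F c \<longleftrightarrow> c \<in> tract_hom F F \<and> (\<forall>x \<in> carrier F. c (c x) = x)"


section \<open>Orthogonal matroids\<close>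

text \<open>
  The element \<open>i\<close> of \<open>[n]\<close> is the integer \<open>i\<close>, and \<open>i\<^sup>*\<close> is the integer \<open>-i\<close>;
  thus \<open>[n] = {1..int n}\<close> and \<open>*\<close> is \<^term>\<open>uminus\<close>.
\<close>

definition ground :: "nat \<Rightarrow> int set" where
  "ground n = {1..int n} \<union> uminus ` {1..int n}"

definition admissible :: "nat \<Rightarrow> int set \<Rightarrow> bool" where
  "admissible n A \<longleftrightarrow> A \<subseteq> ground n \<and> A \<inter> uminus ` A = {}"

definition transversals :: "nat \<Rightarrow> int set set" where
  "transversals n = {T. admissible n T \<and> card T = n}"

definition orthogonal_matroid :: "nat \<Rightarrow> int set set \<Rightarrow> bool" where
  "orthogonal_matroid n \<B> \<longleftrightarrow>
     \<B> \<noteq> {} \<and> \<B> \<subseteq> transversals n \<and>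
     (\<forall>B\<^sub>1 \<in> \<B>. \<forall>B\<^sub>2 \<in> \<B>. \<forall>x\<^sub>1. {x\<^sub>1, - x\<^sub>1} \<subseteq> sym_diff B\<^sub>1 B\<^sub>2 \<longrightarrow>
        (\<exists>x\<^sub>2. {x\<^sub>2, - x\<^sub>2} \<subseteq> sym_diff B\<^sub>1 B\<^sub>2 \<and> {x\<^sub>2, - x\<^sub>2} \<noteq> {x\<^sub>1, - x\<^sub>1} \<and>
              sym_diff B\<^sub>1 {x\<^sub>1, - x\<^sub>1, x\<^sub>2, - x\<^sub>2} \<in> \<B>))"

definition dependent :: "nat \<Rightarrow> int set set \<Rightarrow> int set \<Rightarrow> bool" where
  "dependent n \<B> A \<longleftrightarrow> admissible n A \<and> \<not> (\<exists>B \<in> \<B>. A \<subseteq> B)"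

definition circuits :: "nat \<Rightarrow> int set set \<Rightarrow> int set set" where
  "circuits n \<B> = {C. dependent n \<B> C \<and> (\<forall>D. dependent n \<B> D \<and> D \<subseteq> C \<longrightarrow> D = C)}"


section \<open>Moderately weak orthogonal matroids over a tract\<close>

text \<open>
  Functions on transversals and vectors indexed by the ground set are total functions that
  take the value 0 outside their domain.
\<close>

definition flip :: "int set \<Rightarrow> int \<Rightarrow> int set" where
  "flip T x = sym_diff T {x, - x}"

definition wick_product ::
  "('a, 'm) tract_scheme \<Rightarrow> (int set \<Rightarrow> 'a option) \<Rightarrow> int set \<Rightarrow> int set \<Rightarrow> int \<Rightarrow> 'a option" where
  "wick_product F \<phi> T\<^sub>1 T\<^sub>2 x = tmult F (\<phi> (flip T\<^sub>1 x)) (\<phi> (flip T\<^sub>2 x))"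

definition mw_wick_function ::
  "('a, 'm) tract_scheme \<Rightarrow> nat \<Rightarrow> (int set \<Rightarrow> 'a option) \<Rightarrow> bool" where
  "mw_wick_function F n \<phi> \<longleftrightarrow>
     (\<forall>T \<in> transversals n. \<phi> T \<in> elts F) \<and>
     (\<forall>T. T \<notin> transversals n \<longrightarrow> \<phi> T = None) \<and>
     (\<exists>T \<in> transversals n. \<phi> T \<noteq> None) \<and>
     orthogonal_matroid n {T \<in> transversals n. \<phi> T \<noteq> None} \<and>
     (\<forall>T\<^sub>1 \<in> transversals n. \<forall>T\<^sub>2 \<in> transversals n.
        let xs = sorted_list_of_set (sym_diff T\<^sub>1 T\<^sub>2 \<inter> {1..int n}); m = length xs in
          card {k \<in> {1..m}. wick_product F \<phi> T\<^sub>1 T\<^sub>2 (xs ! (k - 1)) \<noteq> None} \<le> 4 \<longrightarrow>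
          (\<Sum>k = 1..m. formal (alt_sign F k (wick_product F \<phi> T\<^sub>1 T\<^sub>2 (xs ! (k - 1)))))
            \<in> null_set F)"

definition wick_equiv ::
  "('a, 'm) tract_scheme \<Rightarrow> nat \<Rightarrow> ((int set \<Rightarrow> 'a option) \<times> (int set \<Rightarrow> 'a option)) set" where
  "wick_equiv F n = {(\<phi>, \<psi>). mw_wick_function F n \<phi> \<and> mw_wick_function F n \<psi> \<and>
     (\<exists>\<alpha> \<in> carrier F. \<psi> = (\<lambda>T. tmult F (Some \<alpha>) (\<phi> T)))}"

definition mw_orthogonal_matroids ::
  "('a, 'm) tract_scheme \<Rightarrow> nat \<Rightarrow> (int set \<Rightarrow> 'a option) set set" where
  "mw_orthogonal_matroids F n = {\<phi>. mw_wick_function F n \<phi>} // wick_equiv F n"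


section \<open>Weak orthogonal signatures\<close>

definition vectors :: "('a, 'm) tract_scheme \<Rightarrow> nat \<Rightarrow> (int \<Rightarrow> 'a option) set" where
  "vectors F n = {X. (\<forall>i \<in> ground n. X i \<in> elts F) \<and> (\<forall>i. i \<notin> ground n \<longrightarrow> X i = None)}"

definition supp :: "(int \<Rightarrow> 'a option) \<Rightarrow> int set" where
  "supp X = {i. X i \<noteq> None}"

definition star :: "(int \<Rightarrow> 'a option) \<Rightarrow> int \<Rightarrow> 'a option" where
  "star X = (\<lambda>i. X (- i))"

definition inner_product ::
  "('a, 'm) tract_scheme \<Rightarrow> ('a \<Rightarrow> 'a) \<Rightarrow> nat \<Rightarrow>
     (int \<Rightarrow> 'a option) \<Rightarrow> (int \<Rightarrow> 'a option) \<Rightarrow> 'a multiset" where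
  "inner_product F c n X Y =
     (\<Sum>i \<in> {1..int n}. formal (tmult F (X i) (map_option c (Y i))) +
                       formal (tmult F (map_option c (X (- i))) (Y (- i))))"

text \<open>
  Scalars act on the coordinates in \<open>[n]\<^sup>*\<close> through the involution, since the inner product
  conjugates its left argument, not its right one, in these coordinates. With this action
  the inner product of \<open>\<alpha> X\<close> and \<open>Y\<close> is \<open>\<alpha>\<close> times that of \<open>X\<close> and \<open>Y\<close>.
  For the trivial involution it is plain coordinatewise multiplication (lemma
  \<open>scale_trivial_involution\<close> below). For a nontrivial involution, plain coordinatewise
  multiplication would not preserve orthogonality: the matroid with bases \<open>{1, 2}\<close> and
  \<open>{1\<^sup>*, 2\<^sup>*}\<close> would then carry no weak signature, although it underlies moderately weak matroids.
\<close>

definition scale ::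
  "('a, 'm) tract_scheme \<Rightarrow> ('a \<Rightarrow> 'a) \<Rightarrow> 'a \<Rightarrow> (int \<Rightarrow> 'a option) \<Rightarrow> int \<Rightarrow> 'a option" where
  "scale F c \<alpha> X = (\<lambda>i. tmult F (Some (if 0 < i then \<alpha> else c \<alpha>)) (X i))"

lemma scale_trivial_involution:
  assumes "\<And>x. x \<in> carrier F \<Longrightarrow> c x = x" and "\<alpha> \<in> carrier F"
  shows "scale F c \<alpha> X = (\<lambda>i. tmult F (Some \<alpha>) (X i))"
  using assms by (auto simp: scale_def)

definition signature_of ::
  "('a, 'm) tract_scheme \<Rightarrow> ('a \<Rightarrow> 'a) \<Rightarrow> nat \<Rightarrow> int set set \<Rightarrow> (int \<Rightarrow> 'a option) set \<Rightarrow> bool" where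
  "signature_of F c n \<B> \<C> \<longleftrightarrow>
     \<C> \<subseteq> vectors F n \<and> supp ` \<C> = circuits n \<B> \<and>
     (\<forall>X \<in> \<C>. \<forall>\<alpha> \<in> carrier F. scale F c \<alpha> X \<in> \<C>)"

definition weak_signature_of ::
  "('a, 'm) tract_scheme \<Rightarrow> ('a \<Rightarrow> 'a) \<Rightarrow> nat \<Rightarrow> int set set \<Rightarrow> (int \<Rightarrow> 'a option) set \<Rightarrow> bool" where
  "weak_signature_of F c n \<B> \<C> \<longleftrightarrow>
     signature_of F c n \<B> \<C> \<and>
     (\<forall>X \<in> \<C>. \<forall>Y \<in> \<C>. card (supp X \<inter> uminus ` supp Y) \<le> 4 \<longrightarrow>
        inner_product F c n X (star Y) \<in> null_set F)"

definition weak_orthogonal_signatures ::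
  "('a, 'm) tract_scheme \<Rightarrow> ('a \<Rightarrow> 'a) \<Rightarrow> nat \<Rightarrow> (int \<Rightarrow> 'a option) set set" where
  "weak_orthogonal_signatures F c n =
     {\<C>. \<exists>\<B>. orthogonal_matroid n \<B> \<and> weak_signature_of F c n \<B> \<C>}"


section \<open>The signature of a Wick function\<close>

text \<open>
  If some \<open>T \<triangle> {x, x\<^sup>*}\<close> is a basis, then the support of \<open>circuit_vector F c \<phi> T\<close> is the
  unique circuit contained in \<open>T\<close>; otherwise the vector is zero. The sign \<open>(-1)\<^sup>k\<close>, where
  \<open>k\<close> is the number of elements of \<open>T \<inter> [n]\<close> up to \<open>x\<close>, and the conjugation on \<open>[n]\<^sup>*\<close> turn
  the inner product of \<open>circuit_vector F c \<phi> T\<^sub>1\<close> with the star of \<open>circuit_vector F c \<phi> T\<^sub>2\<close>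
  into the Wick sum for \<open>T\<^sub>1\<close> and \<open>T\<^sub>2\<close>, up to a global sign.
\<close>

definition circuit_vector ::
  "('a, 'm) tract_scheme \<Rightarrow> ('a \<Rightarrow> 'a) \<Rightarrow> (int set \<Rightarrow> 'a option) \<Rightarrow> int set \<Rightarrow> int \<Rightarrow> 'a option" where
  "circuit_vector F c \<phi> T x =
     (if x \<in> T then
        alt_sign F (card (T \<inter> {1..\<bar>x\<bar>}))
          (if 0 < x then \<phi> (flip T x) else map_option c (\<phi> (flip T x)))
      else None)"

definition wick_signature ::
  "('a, 'm) tract_scheme \<Rightarrow> ('a \<Rightarrow> 'a) \<Rightarrow> nat \<Rightarrow> (int set \<Rightarrow> 'a option) \<Rightarrow> (int \<Rightarrow> 'a option) set" where
  "wick_signature F c n \<phi> =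
     {scale F c \<alpha> (circuit_vector F c \<phi> T) | \<alpha> T.
        \<alpha> \<in> carrier F \<and> T \<in> transversals n \<and> supp (circuit_vector F c \<phi> T) \<noteq> {}}"

end

theory Submission
  imports Defs
begin

text \<open>
  A transversal \<open>T\<close> obtained from a basis by one flip contains a unique circuit
  \<open>{x \<in> T. flip T x is a basis}\<close>, and every circuit arises in this way. The inner product of
  the circuit vectors of \<open>T\<^sub>1\<close> and \<open>T\<^sub>2\<close> is exactly the Wick sum of \<open>T\<^sub>1\<close> and \<open>T\<^sub>2\<close>, so a
  moderately weak Wick function yields a weak signature. In a weak signature, orthogonality
  relations with only two terms determine each vector from its support up to a scalar; as
  the bases are connected by double flips, the Wick function is determined up to a scalar.

  Conversely, a weak signature prescribes the quotients \<open>\<phi>(B') / \<phi>(B)\<close> for bases \<open>B\<close>, \<open>B'\<close>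
  differing by a double flip. These quotients multiply to 1 around triangles, because the
  bases of a triangle are flips of one common transversal, and around those squares that
  cannot be cut into triangles, by two relations with two terms each. This suffices to
  integrate them to a function \<open>\<phi>\<close>, by induction on the distance from a fixed basis \<open>B\<^sub>0\<close>:
  two neighbours of \<open>B\<close> closer to \<open>B\<^sub>0\<close> are joined, by the exchange axiom applied to them,
  through triangles or one square; and two adjacent bases at equal distance have a common
  neighbour closer to \<open>B\<^sub>0\<close>.
\<close>

section \<open>Transversals, bases and circuits\<close>

lemma flip_iff: "z \<in> flip T x \<longleftrightarrow> (if z = x \<or> z = - x then z \<notin> T else z \<in> T)"
  by (auto simp: flip_def)

lemma flip_commute: "flip (flip T x) y = flip (flip T y) x"
  by (auto simp: set_eq_iff flip_iff)

lemma flip_uminus [simp]: "flip T (- x) = flip T x"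
  by (auto simp: flip_def)

lemma flip_flip [simp]: "flip (flip T x) x = T"
  by (auto simp: set_eq_iff flip_iff)

lemma flip_eq_iff [simp]: "flip T x = flip T y \<longleftrightarrow> x = y \<or> x = - y"
proof
  assume "flip T x = flip T y"
  then have "x \<in> flip T x \<longleftrightarrow> x \<in> flip T y" by simp
  then show "x = y \<or> x = - y" by (auto simp: flip_iff split: if_splits)
qed auto

lemma mem_uminus_image: "y \<in> uminus ` A \<longleftrightarrow> - y \<in> A" for y :: int
  by (metis image_iff minus_minus)

lemma ground_iff: "i \<in> ground n \<longleftrightarrow> 1 \<le> \<bar>i\<bar> \<and> \<bar>i\<bar> \<le> int n"
proof -
  have "uminus ` {1..int n} = {- int n..- 1}" by simp
  then show ?thesis by (auto simp: ground_def)
qed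

lemma finite_ground [simp]: "finite (ground n)"
  by (simp add: ground_def)

text \<open>On an admissible set the absolute value is injective with values in \<open>[n]\<close>,
  so having \<open>n\<close> elements amounts to meeting every pair \<open>{i, - i}\<close>. This
  removes cardinalities from most later arguments.\<close>

lemma transversal_iff:
  "T \<in> transversals n \<longleftrightarrow> T \<subseteq> ground n \<and> (\<forall>i \<in> ground n. - i \<in> T \<longleftrightarrow> i \<notin> T)"
proof -
  have *: "inj_on abs T" if "T \<inter> uminus ` T = {}"
    using that by (auto simp: inj_on_def abs_if disjoint_iff split: if_splits)
  have **: "abs ` T \<subseteq> {1..int n}" if "T \<subseteq> ground n"
    using that by (auto simp: ground_iff subset_iff)
  show ?thesis
  proof
    assume "T \<in> transversals n"
    then have T: "T \<subseteq> ground n" "T \<inter> uminus ` T = {}" "card T = n"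
      by (auto simp: transversals_def admissible_def)
    have "abs ` T = {1..int n}"
      using **[OF T(1)] card_image[OF *[OF T(2)]] T(3) by (intro card_subset_eq) auto
    then have "i \<in> T \<or> - i \<in> T" if "i \<in> ground n" for i
    proof -
      have "\<bar>i\<bar> \<in> abs ` T" using that \<open>abs ` T = {1..int n}\<close> by (simp add: ground_iff)
      then obtain j where "j \<in> T" "\<bar>i\<bar> = \<bar>j\<bar>" by blast
      then show ?thesis by (metis abs_eq_iff minus_minus)
    qed
    with T show "T \<subseteq> ground n \<and> (\<forall>i \<in> ground n. - i \<in> T \<longleftrightarrow> i \<notin> T)"
      by (auto simp: disjoint_iff image_iff)
  next
    assume T: "T \<subseteq> ground n \<and> (\<forall>i \<in> ground n. - i \<in> T \<longleftrightarrow> i \<notin> T)"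
    then have d: "T \<inter> uminus ` T = {}" by auto
    have "{1..int n} \<subseteq> abs ` T"
    proof
      fix i assume i: "i \<in> {1..int n}"
      then have "i \<in> ground n" by (simp add: ground_iff)
      with T have "i \<in> T \<or> - i \<in> T" by auto
      moreover have "i = \<bar>i\<bar>" "i = \<bar>- i\<bar>" using i by auto
      ultimately show "i \<in> abs ` T" by blast
    qed
    with ** T have "abs ` T = {1..int n}" by blast
    then have "card T = n" using card_image[OF *[OF d]] by simp
    with T d show "T \<in> transversals n" by (auto simp: transversals_def admissible_def)
  qed
qed

lemma transversal_subset_ground: "T \<in> transversals n \<Longrightarrow> x \<in> T \<Longrightarrow> x \<in> ground n"
  by (auto simp: transversal_iff)

lemma transversal_uminus: "T \<in> transversals n \<Longrightarrow> x \<in> T \<Longrightarrow> - x \<notin> T"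
  by (auto simp: transversal_iff)

lemma ground_uminus [simp]: "- i \<in> ground n \<longleftrightarrow> i \<in> ground n"
  by (simp add: ground_iff)

lemma transversal_flip: "T \<in> transversals n \<Longrightarrow> x \<in> ground n \<Longrightarrow> flip T x \<in> transversals n"
  by (auto simp: transversal_iff flip_iff subset_iff split: if_splits)

lemma transversal_eqI: "S \<in> transversals n \<Longrightarrow> T \<in> transversals n \<Longrightarrow> S \<subseteq> T \<Longrightarrow> S = T"
  unfolding transversal_iff by blast

lemma finite_transversal: "T \<in> transversals n \<Longrightarrow> finite T"
  using finite_subset[OF _ finite_ground] by (auto simp: transversal_iff)

text \<open>Described by single flips rather than by minimality, which makes its elements directly
  comparable with bases. For a transversal \<open>T\<close> it is empty exactly when no flip of
  \<open>T\<close> is a basis; otherwise it will be the unique circuit inside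
  \<open>T\<close>.\<close>

definition fund_circuit :: "int set set \<Rightarrow> int set \<Rightarrow> int set" where
  "fund_circuit \<B> T = {x \<in> T. flip T x \<in> \<B>}"

section \<open>Fundamental circuits and the passage between circuits and bases\<close>

locale matroid_bases =
  fixes n :: nat and \<B> :: "int set set"
  assumes matroid: "orthogonal_matroid n \<B>"
begin

lemma bases_nonempty: "\<B> \<noteq> {}"
  and basis_transversal: "B \<in> \<B> \<Longrightarrow> B \<in> transversals n"
  using matroid by (auto simp: orthogonal_matroid_def)

text \<open>The pair supplied by the exchange axiom has exactly one member in
  \<open>B\<^sub>1\<close>. Choosing that member lets exchanges be tracked by elements of
  \<open>B\<^sub>1 - B\<^sub>2\<close> and written as two successive flips.\<close>

lemma exchange:
  assumes "B\<^sub>1 \<in> \<B>" "B\<^sub>2 \<in> \<B>" "x \<in> B\<^sub>1" "x \<notin> B\<^sub>2"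
  obtains y where "y \<in> B\<^sub>1" "y \<notin> B\<^sub>2" "y \<noteq> x" "flip (flip B\<^sub>1 x) y \<in> \<B>"
proof -
  have tr: "B\<^sub>1 \<in> transversals n" "B\<^sub>2 \<in> transversals n"
    using assms basis_transversal by auto
  then have "{x, - x} \<subseteq> sym_diff B\<^sub>1 B\<^sub>2"
    using assms by (auto simp: transversal_iff)
  then obtain z where z: "{z, - z} \<subseteq> sym_diff B\<^sub>1 B\<^sub>2" "{z, - z} \<noteq> {x, - x}"
    "sym_diff B\<^sub>1 {x, - x, z, - z} \<in> \<B>"
    using matroid assms unfolding orthogonal_matroid_def by metis
  define y where "y = (if z \<in> B\<^sub>1 then z else - z)"
  have "z \<in> ground n" using z tr by (auto simp: transversal_iff)
  then have "y \<in> B\<^sub>1" "y \<notin> B\<^sub>2" using z tr by (auto simp: y_def transversal_iff)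
  moreover have "y \<noteq> x" "y \<noteq> - x" using z(2) by (auto simp: y_def split: if_splits)
  moreover have "{x, - x, z, - z} = {x, - x, y, - y}" by (auto simp: y_def)
  with z(3) have "sym_diff B\<^sub>1 {x, - x, y, - y} \<in> \<B>" by simp
  moreover have "sym_diff B\<^sub>1 {x, - x, y, - y} = flip (flip B\<^sub>1 x) y"
    using \<open>y \<noteq> x\<close> \<open>y \<noteq> - x\<close> by (auto simp: set_eq_iff flip_iff)
  ultimately show ?thesis using that by simp
qed

lemma fund_circuit_subset: "fund_circuit \<B> T \<subseteq> T"
  by (auto simp: fund_circuit_def)

text \<open>If \<open>A\<close> misses an element \<open>x\<close> of the fundamental circuit, it
  lies in the basis \<open>flip T x\<close>. If \<open>A\<close> contains the whole fundamental
  circuit, a basis above \<open>A\<close> would produce, by exchange, a further element of that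
  circuit outside the basis.\<close>

lemma dependent_iff_fund_circuit:
  assumes T: "T \<in> transversals n" "fund_circuit \<B> T \<noteq> {}" and A: "A \<subseteq> T"
  shows "dependent n \<B> A \<longleftrightarrow> fund_circuit \<B> T \<subseteq> A"
proof
  assume d: "dependent n \<B> A"
  show "fund_circuit \<B> T \<subseteq> A"
  proof
    fix x assume x: "x \<in> fund_circuit \<B> T"
    show "x \<in> A"
    proof (rule ccontr)
      assume "x \<notin> A"
      then have "A \<subseteq> flip T x"
        using A x transversal_uminus[OF T(1), of x]
        by (auto simp: subset_iff flip_iff fund_circuit_def)
      then show False using d x by (auto simp: dependent_def fund_circuit_def)
    qed
  qed
next
  assume sub: "fund_circuit \<B> T \<subseteq> A"
  have "False" if B: "B \<in> \<B>" "A \<subseteq> B" for B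
  proof -
    obtain e where e: "e \<in> T" "flip T e \<in> \<B>" "e \<in> B"
      using T(2) B sub by (auto simp: fund_circuit_def)
    have me: "- e \<in> flip T e" "- e \<notin> B"
      using e T B basis_transversal by (auto simp: flip_iff transversal_iff)
    \<comment> \<open>Exchanging \<open>- e\<close> undoes the flip at \<open>e\<close>, so the new
      basis is \<open>flip T f\<close>. Hence \<open>f\<close> is in the fundamental circuit
      although \<open>f \<notin> B\<close>.\<close>
    obtain f where f: "f \<in> flip T e" "f \<notin> B" "f \<noteq> - e" "flip (flip (flip T e) (- e)) f \<in> \<B>"
      using exchange[OF e(2) B(1) me] by metis
    then have "f \<in> T" using e T by (auto simp: flip_iff split: if_splits)
    then have "f \<in> fund_circuit \<B> T" using f by (simp add: fund_circuit_def)
    then show False using f sub B by auto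
  qed
  moreover have "admissible n A" using A T by (auto simp: transversals_def admissible_def)
  ultimately show "dependent n \<B> A" by (auto simp: dependent_def)
qed

text \<open>The dependent subsets of \<open>T\<close> are exactly those above the fundamental
  circuit, so the latter is the only minimal one.\<close>

lemma circuit_in_transversal:
  assumes T: "T \<in> transversals n" "fund_circuit \<B> T \<noteq> {}"
  shows "C \<in> circuits n \<B> \<and> C \<subseteq> T \<longleftrightarrow> C = fund_circuit \<B> T"
proof
  assume C: "C \<in> circuits n \<B> \<and> C \<subseteq> T"
  then have "fund_circuit \<B> T \<subseteq> C"
    using dependent_iff_fund_circuit[OF T, of C] by (simp add: circuits_def)
  moreover have "dependent n \<B> (fund_circuit \<B> T)"
    using dependent_iff_fund_circuit[OF T fund_circuit_subset] by simp
  ultimately show "C = fund_circuit \<B> T"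
    using C unfolding circuits_def by blast
next
  assume C: "C = fund_circuit \<B> T"
  have "D = C" if D: "dependent n \<B> D" "D \<subseteq> C" for D
    using dependent_iff_fund_circuit[OF T, of D] D C fund_circuit_subset[of T] by auto
  moreover have "dependent n \<B> C"
    using dependent_iff_fund_circuit[OF T fund_circuit_subset] C by simp
  ultimately show "C \<in> circuits n \<B> \<and> C \<subseteq> T"
    using C fund_circuit_subset by (auto simp: circuits_def)
qed

text \<open>Delete an element \<open>e\<close> of the circuit: by minimality the rest lies in a
  basis \<open>B\<close>, and then the circuit lies in \<open>flip B e\<close>, which is one flip
  away from a basis.\<close>

lemma fund_circuit_of_circuit:
  assumes C: "C \<in> circuits n \<B>"
  obtains T where "T \<in> transversals n" "fund_circuit \<B> T = C"
proof -
  have dep: "dependent n \<B> C" and min: "\<And>D. dependent n \<B> D \<Longrightarrow> D \<subseteq> C \<Longrightarrow> D = C"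
    using C by (auto simp: circuits_def)
  obtain e where e: "e \<in> C" using dep bases_nonempty by (auto simp: dependent_def)
  have adm: "admissible n C" using dep by (simp add: dependent_def)
  have "\<not> dependent n \<B> (C - {e})" using min[of "C - {e}"] e by auto
  moreover have "admissible n (C - {e})" using adm by (auto simp: admissible_def)
  ultimately obtain B where B: "B \<in> \<B>" "C - {e} \<subseteq> B" by (auto simp: dependent_def)
  have eg: "e \<in> ground n" using adm e by (auto simp: admissible_def)
  have "e \<notin> B" using B dep e by (auto simp: dependent_def)
  have T: "flip B e \<in> transversals n"
    using transversal_flip basis_transversal B eg by blast
  have "- e \<notin> C" using adm e by (auto simp: admissible_def)
  then have sub: "C \<subseteq> flip B e" using B \<open>e \<notin> B\<close> by (auto simp: flip_iff)
  have "e \<in> fund_circuit \<B> (flip B e)" using B \<open>e \<notin> B\<close> by (auto simp: fund_circuit_def flip_iff)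
  then show ?thesis
    using that[OF T] circuit_in_transversal[OF T] C sub by blast
qed

lemma circuits_eq: "circuits n \<B> = {fund_circuit \<B> T | T. T \<in> transversals n \<and> fund_circuit \<B> T \<noteq> {}}"
proof (intro equalityI subsetI)
  fix C assume C: "C \<in> circuits n \<B>"
  then have "C \<noteq> {}" using bases_nonempty by (auto simp: circuits_def dependent_def)
  with fund_circuit_of_circuit[OF C]
  show "C \<in> {fund_circuit \<B> T | T. T \<in> transversals n \<and> fund_circuit \<B> T \<noteq> {}}"
    by blast
qed (use circuit_in_transversal in auto)

text \<open>A transversal that is not a basis is dependent, since transversals are never properly
  nested; by finiteness it contains a minimal dependent set.\<close>

lemma basis_iff_no_circuit:
  assumes T: "T \<in> transversals n"
  shows "T \<in> \<B> \<longleftrightarrow> (\<forall>C \<in> circuits n \<B>. \<not> C \<subseteq> T)"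
proof
  assume "T \<in> \<B>" then show "\<forall>C \<in> circuits n \<B>. \<not> C \<subseteq> T"
    by (auto simp: circuits_def dependent_def)
next
  assume no: "\<forall>C \<in> circuits n \<B>. \<not> C \<subseteq> T"
  show "T \<in> \<B>"
  proof (rule ccontr)
    assume "T \<notin> \<B>"
    then have dep: "dependent n \<B> T"
      using T basis_transversal transversal_eqI unfolding dependent_def transversals_def by blast
    have "finite {D. dependent n \<B> D \<and> D \<subseteq> T}"
      using finite_transversal[OF T] by (auto intro: finite_subset[of _ "Pow T"])
    then obtain C where C: "C \<subseteq> T" "dependent n \<B> C"
      "\<And>D. dependent n \<B> D \<Longrightarrow> D \<subseteq> T \<Longrightarrow> D \<subseteq> C \<Longrightarrow> D = C"
      using finite_has_minimal2[of "{D. dependent n \<B> D \<and> D \<subseteq> T}" T] dep by (auto 0 0) metis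
    then have "C \<in> circuits n \<B>" by (auto simp: circuits_def)
    with no C show False by blast
  qed
qed

end

text \<open>A signature records its matroid only through circuits. Recovering the bases from them
  shows that functions with equal signatures have equal supports.\<close>

lemma circuits_inject:
  assumes "orthogonal_matroid n \<B>" "orthogonal_matroid n \<B>'" "circuits n \<B> = circuits n \<B>'"
  shows "\<B> = \<B>'"
proof -
  interpret M: matroid_bases n \<B> by unfold_locales fact
  interpret N: matroid_bases n \<B>' by unfold_locales fact
  have "B \<in> \<B> \<longleftrightarrow> B \<in> \<B>'" for B
    using M.basis_iff_no_circuit[of B] N.basis_iff_no_circuit[of B] M.basis_transversal[of B]
      N.basis_transversal[of B] assms(3) by metis
  then show ?thesis by blast
qed

section \<open>Integration over the graph of bases\<close>

text \<open>For a transversal \<open>T\<close>, any two distinct members differ by a double flip, so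
  each \<open>T\<close> spans a clique in the graph of bases. Edges and triangles are always handled
  inside such a clique.\<close>

definition adjacent_bases :: "int set set \<Rightarrow> int set \<Rightarrow> int set set" where
  "adjacent_bases \<B> T = flip T ` fund_circuit \<B> T"

context matroid_bases
begin

lemma adjacent_bases_subset: "adjacent_bases \<B> T \<subseteq> \<B>"
  by (auto simp: adjacent_bases_def fund_circuit_def)

lemma basis_adjacent:
  assumes "B \<in> \<B>" "x \<in> B"
  shows "B \<in> adjacent_bases \<B> (flip B x)"
proof -
  have "- x \<in> flip B x" using assms basis_transversal by (auto simp: flip_iff transversal_iff)
  then have "- x \<in> fund_circuit \<B> (flip B x)" using assms by (simp add: fund_circuit_def)
  moreover have "B = flip (flip B x) (- x)" by simp
  ultimately show ?thesis unfolding adjacent_bases_def by blast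
qed

lemma double_flip_adjacent:
  assumes "B \<in> \<B>" "x \<in> B" "y \<in> B" "x \<noteq> y" "flip (flip B x) y \<in> \<B>"
  shows "flip (flip B x) y \<in> adjacent_bases \<B> (flip B x)"
proof -
  have "y \<in> flip B x"
    using assms basis_transversal[of B] by (auto simp: flip_iff transversal_iff)
  then show ?thesis using assms by (auto simp: adjacent_bases_def fund_circuit_def)
qed

lemma adjacent_bases_cases:
  assumes "T \<in> transversals n" "B \<in> adjacent_bases \<B> T" "B' \<in> adjacent_bases \<B> T"
  obtains "B = B'" | x y where "x \<in> B" "y \<in> B" "x \<noteq> y" "B' = flip (flip B x) y" "T = flip B x"
proof -
  obtain x y where xy: "x \<in> T" "y \<in> T" "B = flip T x" "B' = flip T y"
    using assms by (auto simp: adjacent_bases_def fund_circuit_def)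
  show ?thesis
  proof (cases "x = y")
    case False
    have "- x \<in> B" "y \<in> B" "- x \<noteq> y"
      using xy False assms(1) by (auto simp: flip_iff transversal_iff)
    moreover have "B' = flip (flip B (- x)) y" "T = flip B (- x)" using xy by simp_all
    ultimately show ?thesis by (rule that(2))
  qed (use that(1) xy in simp)
qed

text \<open>Each flipped element outside \<open>B\<^sub>0\<close> lowers the distance
  \<open>card (B - B\<^sub>0)\<close> by one and each one inside raises it by one. The mixed case is
  given in one order; the other follows by commuting the flips.\<close>

lemma double_flip_distance:
  assumes B: "B \<in> \<B>" "B\<^sub>0 \<in> \<B>" and xy: "x \<in> B" "y \<in> B" "x \<noteq> y"
  shows "x \<notin> B\<^sub>0 \<Longrightarrow> y \<notin> B\<^sub>0 \<Longrightarrow> card (B - B\<^sub>0) = card (flip (flip B x) y - B\<^sub>0) + 2"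
    and "x \<in> B\<^sub>0 \<Longrightarrow> y \<in> B\<^sub>0 \<Longrightarrow> card (flip (flip B x) y - B\<^sub>0) = card (B - B\<^sub>0) + 2"
    and "x \<notin> B\<^sub>0 \<Longrightarrow> y \<in> B\<^sub>0 \<Longrightarrow> card (flip (flip B x) y - B\<^sub>0) = card (B - B\<^sub>0)"
proof -
  have t: "B \<in> transversals n" "B\<^sub>0 \<in> transversals n" using B basis_transversal by auto
  have g: "x \<in> ground n" "y \<in> ground n" "- x \<notin> B" "- y \<notin> B"
    "- x \<in> B\<^sub>0 \<longleftrightarrow> x \<notin> B\<^sub>0" "- y \<in> B\<^sub>0 \<longleftrightarrow> y \<notin> B\<^sub>0"
    using t xy by (auto simp: transversal_iff)
  have fin: "finite B" using t finite_transversal by blast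
  have ne: "x \<noteq> - y" "- x \<noteq> - y" "y \<noteq> - x" using g xy by auto
  show "card (B - B\<^sub>0) = card (flip (flip B x) y - B\<^sub>0) + 2" if "x \<notin> B\<^sub>0" "y \<notin> B\<^sub>0"
  proof -
    have "B - B\<^sub>0 = insert x (insert y (flip (flip B x) y - B\<^sub>0))"
      using that g xy ne by (auto simp: set_eq_iff flip_iff)
    moreover have "x \<notin> flip (flip B x) y" "y \<notin> flip (flip B x) y"
      using xy ne by (auto simp: flip_iff)
    moreover have "finite (flip (flip B x) y)" using fin by (simp add: flip_def)
    ultimately show ?thesis using xy by simp
  qed
  show "card (flip (flip B x) y - B\<^sub>0) = card (B - B\<^sub>0) + 2" if "x \<in> B\<^sub>0" "y \<in> B\<^sub>0"
  proof -
    have "flip (flip B x) y - B\<^sub>0 = insert (- x) (insert (- y) (B - B\<^sub>0))"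
      using that g xy ne by (auto simp: set_eq_iff flip_iff)
    then show ?thesis using fin g xy by simp
  qed
  show "card (flip (flip B x) y - B\<^sub>0) = card (B - B\<^sub>0)" if "x \<notin> B\<^sub>0" "y \<in> B\<^sub>0"
  proof -
    have "flip (flip B x) y - B\<^sub>0 = insert (- y) (B - B\<^sub>0 - {x})"
      using that g xy ne by (auto simp: set_eq_iff flip_iff)
    moreover have "x \<in> B - B\<^sub>0" using xy that by simp
    ultimately show ?thesis using fin g
      by (simp add: card.remove[of "B - B\<^sub>0" x] del: card_Diff_insert)
  qed
qed

text \<open>A discrete Poincare lemma: \<open>r\<close> is a multiplicative cocycle on the cliques,
  and closing up around chordless squares is enough to make it a coboundary. The function is built
  level by level in the distance from \<open>B\<^sub>0\<close>; on a new level its values are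
  transported from the levels below, and the work lies in showing that the route does not
  matter.\<close>

lemma potential:
  fixes G (structure) and r :: "int set \<Rightarrow> int set \<Rightarrow> 'g"
  assumes G: "comm_group G"
    and r_closed: "\<And>T B B'. T \<in> transversals n \<Longrightarrow>
      B \<in> adjacent_bases \<B> T \<Longrightarrow> B' \<in> adjacent_bases \<B> T \<Longrightarrow> r B B' \<in> carrier G"
    and triangle: "\<And>T B B' B''. T \<in> transversals n \<Longrightarrow> B \<in> adjacent_bases \<B> T \<Longrightarrow>
      B' \<in> adjacent_bases \<B> T \<Longrightarrow> B'' \<in> adjacent_bases \<B> T \<Longrightarrow> r B B' \<otimes> r B' B'' = r B B''"
    and square: "\<And>B x y z w. B \<in> \<B> \<Longrightarrow> {x, y, z, w} \<subseteq> B \<Longrightarrow> distinct [x, y, z, w] \<Longrightarrow>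
      flip (flip B x) y \<in> \<B> \<Longrightarrow> flip (flip B z) w \<in> \<B> \<Longrightarrow>
      flip (flip (flip (flip B x) y) z) w \<in> \<B> \<Longrightarrow>
      flip (flip B x) z \<notin> \<B> \<Longrightarrow> flip (flip B x) w \<notin> \<B> \<Longrightarrow>
      flip (flip B y) z \<notin> \<B> \<Longrightarrow> flip (flip B y) w \<notin> \<B> \<Longrightarrow>
      r (flip (flip (flip (flip B x) y) z) w) (flip (flip B x) y) \<otimes> r (flip (flip B x) y) B =
      r (flip (flip (flip (flip B x) y) z) w) (flip (flip B z) w) \<otimes> r (flip (flip B z) w) B"
  obtains f where "\<And>B. B \<in> \<B> \<Longrightarrow> f B \<in> carrier G"
    and "\<And>T B B'. T \<in> transversals n \<Longrightarrow> B \<in> adjacent_bases \<B> T \<Longrightarrow>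
      B' \<in> adjacent_bases \<B> T \<Longrightarrow> f B' = f B \<otimes> r B B'"
proof -
  interpret comm_group G by (rule G)
  obtain B\<^sub>0 where B0: "B\<^sub>0 \<in> \<B>" using bases_nonempty by blast
  define d where "d B = card (B - B\<^sub>0)" for B
  \<comment> \<open>The difference equation is required only up to distance \<open>k\<close>, but
    values in the carrier are required at every basis, so that a function for one level can be
    modified on the next level alone.\<close>
  define ok where "ok f k \<longleftrightarrow> (\<forall>B \<in> \<B>. f B \<in> carrier G) \<and>
    (\<forall>T B B'. T \<in> transversals n \<longrightarrow> B \<in> adjacent_bases \<B> T \<longrightarrow> B' \<in> adjacent_bases \<B> T \<longrightarrow>
      d B \<le> k \<longrightarrow> d B' \<le> k \<longrightarrow> f B' = f B \<otimes> r B B')" for f k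
  have adj_in: "B \<in> \<B>" if "B \<in> adjacent_bases \<B> T" for B T
    using that adjacent_bases_subset by blast
  have okD: "f B' = f B \<otimes> r B B'"
    if "ok f k" "T \<in> transversals n" "B \<in> adjacent_bases \<B> T" "B' \<in> adjacent_bases \<B> T"
      "d B \<le> k" "d B' \<le> k" for f k T B B'
    using that unfolding ok_def by blast
  have ok_closed: "f B \<in> carrier G" if "ok f k" "B \<in> \<B>" for f k B
    using that unfolding ok_def by blast
  \<comment> \<open>The triangle rule with three equal bases makes \<open>r B B\<close>
    idempotent.\<close>
  have r_refl: "r B B = \<one>" if "T \<in> transversals n" "B \<in> adjacent_bases \<B> T" for T B
    using triangle[OF that(1) that(2) that(2) that(2)] r_closed[OF that(1) that(2) that(2)] 
    by (metis l_cancel_one)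
  have tr: "flip B x \<in> transversals n" if "B \<in> \<B>" "x \<in> B" for B x
    using that basis_transversal transversal_flip transversal_subset_ground by metis

  \<comment> \<open>Two lower neighbours of \<open>B\<close> with a common flipped element
    \<open>x\<close> lie with \<open>B\<close> in the clique of \<open>flip B x\<close>, so the
    triangle rule compares the two transports.\<close>
  have pair: "f (flip (flip B x) y) \<otimes> r (flip (flip B x) y) B =
      f (flip (flip B x) w) \<otimes> r (flip (flip B x) w) B"
    if f: "ok f k" and B: "B \<in> \<B>" "d B = Suc k"
      and e: "x \<in> B - B\<^sub>0" "y \<in> B - B\<^sub>0" "w \<in> B - B\<^sub>0" "x \<noteq> y" "x \<noteq> w"
      and D: "flip (flip B x) y \<in> \<B>" "flip (flip B x) w \<in> \<B>" for f k B x y w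
  proof -
    let ?T = "flip B x" and ?D1 = "flip (flip B x) y" and ?D2 = "flip (flip B x) w"
    have T: "?T \<in> transversals n" using tr B e by auto
    have n: "B \<in> adjacent_bases \<B> ?T" "?D1 \<in> adjacent_bases \<B> ?T" "?D2 \<in> adjacent_bases \<B> ?T"
      using basis_adjacent[OF B(1), of x] double_flip_adjacent[OF B(1), of x y]
        double_flip_adjacent[OF B(1), of x w] e D by simp_all
    have "d ?D1 \<le> k" "d ?D2 \<le> k"
      using double_flip_distance(1)[OF B(1) B0, of x y]
        double_flip_distance(1)[OF B(1) B0, of x w] e B(2)
      by (auto simp: d_def)
    then have "f ?D2 = f ?D1 \<otimes> r ?D1 ?D2" and "f ?D1 \<in> carrier G"
      using okD[OF f T n(2,3)] ok_closed[OF f D(1)] by simp_all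
    then show ?thesis
      using triangle[OF T n(2,3,1)] r_closed[OF T n(2) n(3)] r_closed[OF T n(3) n(1)]
      by (simp add: m_assoc)
  qed

  \<comment> \<open>Arbitrary lower neighbours: if the flipped pairs meet, or some mixed double flip
    of \<open>B\<close> is a basis, one or two applications of \<open>pair\<close> suffice. What
    remains is a chordless square.\<close>
  have down: "f (flip (flip B x) y) \<otimes> r (flip (flip B x) y) B =
      f (flip (flip B z) w) \<otimes> r (flip (flip B z) w) B"
    if f: "ok f k" and B: "B \<in> \<B>" "d B = Suc k"
      and e: "x \<in> B - B\<^sub>0" "y \<in> B - B\<^sub>0" "x \<noteq> y" "z \<in> B - B\<^sub>0" "w \<in> B - B\<^sub>0" "z \<noteq> w"
      and D: "flip (flip B x) y \<in> \<B>" "flip (flip B z) w \<in> \<B>" for f k B x y z w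
  proof -
    let ?v = "\<lambda>x y. f (flip (flip B x) y) \<otimes> r (flip (flip B x) y) B"
    have p: "?v a b = ?v c d"
      if "{a, b} \<inter> {c, d} \<noteq> {}" "{a, b, c, d} \<subseteq> B - B\<^sub>0" "a \<noteq> b" "c \<noteq> d"
         "flip (flip B a) b \<in> \<B>" "flip (flip B c) d \<in> \<B>" for a b c d
    proof -
      have "a = c \<or> a = d \<or> b = c \<or> b = d" using that(1) by auto
      then show ?thesis
        using pair[OF f B, of a b d] pair[OF f B, of a b c] pair[OF f B, of b a d]
          pair[OF f B, of b a c] that(2-) flip_commute[of B a b] flip_commute[of B c d]
        by (elim disjE) simp_all
    qed
    have q: ?thesis if "a \<in> {x, y}" "b \<in> {z, w}" "flip (flip B a) b \<in> \<B>" "a \<noteq> b" for a b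
    proof -
      have "?v x y = ?v a b" using e D that by (intro p) auto
      also have "\<dots> = ?v z w" using e D that by (intro p) auto
      finally show ?thesis .
    qed
    show ?thesis
    proof (cases "{x, y} \<inter> {z, w} = {} \<and> (\<forall>a \<in> {x, y}. \<forall>b \<in> {z, w}. flip (flip B a) b \<notin> \<B>)")
      case False
      then show ?thesis using p[of x y z w] q e D by auto
    next
      case True
      let ?D1 = "flip (flip B x) y" and ?D2 = "flip (flip B z) w"
      let ?D = "flip (flip ?D1 z) w"
      have nB: "- x \<notin> B" "- y \<notin> B" "- z \<notin> B" "- w \<notin> B"
        using e transversal_uminus[OF basis_transversal[OF B(1)]] by auto
      then have ne: "x \<noteq> - y" "x \<noteq> - z" "x \<noteq> - w" "y \<noteq> - z" "y \<noteq> - w" "z \<noteq> - w"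
        "z \<noteq> - x" "z \<noteq> - y" "w \<noteq> - x" "w \<noteq> - y" "w \<noteq> - z"
        using e by auto
      have ne': "x \<noteq> z" "x \<noteq> w" "y \<noteq> z" "y \<noteq> w" using True by auto
      have "z \<in> ?D1" "z \<notin> ?D2" using e ne ne' by (auto simp: flip_iff)
      then obtain a where a: "a \<in> ?D1" "a \<notin> ?D2" "a \<noteq> z" "flip (flip ?D1 z) a \<in> \<B>"
        using exchange[OF D] by metis
      \<comment> \<open>The exchange at \<open>z\<close> can be completed only by \<open>w\<close>,
        \<open>- x\<close> or \<open>- y\<close>. The last two would produce mixed double flips of
        \<open>B\<close>, which are excluded here, so the fourth corner of the square is a
        basis.\<close>
      have "a = w \<or> a = - x \<or> a = - y" using a e nB by (auto simp: flip_iff split: if_splits)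
      moreover have "flip (flip ?D1 z) x = flip (flip B y) z" "flip (flip ?D1 z) y = flip (flip B x) z"
        by (auto simp: set_eq_iff flip_iff)
      ultimately have Db: "?D \<in> \<B>" and "a = w" using a True by auto
      have sq: "r ?D ?D1 \<otimes> r ?D1 B = r ?D ?D2 \<otimes> r ?D2 B"
        by (rule square) (use B e D Db True ne' in auto)
      have D1m: "z \<in> ?D1" "w \<in> ?D1" and D2m: "x \<in> ?D2" "y \<in> ?D2"
        using e ne ne' by (auto simp: flip_iff)
      have De: "?D = flip (flip ?D2 x) y" by (simp add: flip_commute)
      have n1: "?D1 \<in> adjacent_bases \<B> (flip ?D1 z)" "?D \<in> adjacent_bases \<B> (flip ?D1 z)"
        using basis_adjacent[OF D(1) D1m(1)] double_flip_adjacent[OF D(1) D1m] e(6) Db by simp_all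
      have n2: "?D2 \<in> adjacent_bases \<B> (flip ?D2 x)" "?D \<in> adjacent_bases \<B> (flip ?D2 x)"
        using basis_adjacent[OF D(2) D2m(1)] double_flip_adjacent[OF D(2) D2m] e(3) Db
        unfolding De by simp_all
      have n3: "B \<in> adjacent_bases \<B> (flip B x)" "?D1 \<in> adjacent_bases \<B> (flip B x)"
        "B \<in> adjacent_bases \<B> (flip B z)" "?D2 \<in> adjacent_bases \<B> (flip B z)"
        using basis_adjacent[OF B(1), of x] double_flip_adjacent[OF B(1), of x y]
          basis_adjacent[OF B(1), of z] double_flip_adjacent[OF B(1), of z w] D e by simp_all
      have t: "flip ?D1 z \<in> transversals n" "flip ?D2 x \<in> transversals n"
        "flip B x \<in> transversals n" "flip B z \<in> transversals n"
        using tr D1m D2m B D e by auto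
      have d12: "d ?D1 \<le> k" "d ?D2 \<le> k"
        using double_flip_distance(1)[OF B(1) B0, of x y]
          double_flip_distance(1)[OF B(1) B0, of z w] e B(2)
        by (auto simp: d_def)
      \<comment> \<open>The fourth corner is closer still to \<open>B\<^sub>0\<close>, so the
        inductive equation holds on both edges leaving it, and the square relation transfers the
        equality to \<open>B\<close>.\<close>
      have "d ?D \<le> k"
        using double_flip_distance(1)[OF D(1) B0 D1m] e d12 by (auto simp: d_def)
      then have "f ?D1 = f ?D \<otimes> r ?D ?D1" "f ?D2 = f ?D \<otimes> r ?D ?D2" "f ?D \<in> carrier G"
        using okD[OF f t(1) n1(2,1)] okD[OF f t(2) n2(2,1)] ok_closed[OF f Db] d12 by simp_all
      then show ?thesis
        using sq r_closed[OF t(1) n1(2,1)] r_closed[OF t(2) n2(2,1)]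
          r_closed[OF t(3) n3(2,1)] r_closed[OF t(4) n3(4,3)]
        by (simp add: m_assoc)
    qed
  qed

  have "\<exists>f. ok f k" for k
  proof (induction k)
    case 0
    have "B = B'" if "d B = 0" "d B' = 0" "B \<in> \<B>" "B' \<in> \<B>" for B B'
    proof -
      have "C = B\<^sub>0" if "C \<in> \<B>" "d C = 0" for C
        using that B0 transversal_eqI[of C n B\<^sub>0] basis_transversal finite_transversal[of C n]
        by (auto simp: d_def)
      then show ?thesis using that by metis
    qed
    then have "ok (\<lambda>_. \<one>) 0"
      unfolding ok_def using r_refl adj_in by (metis l_one le_zero_eq one_closed)
    then show ?case by blast
  next
    case (Suc k)
    then obtain f where f: "ok f k" by blast
    \<comment> \<open>An arbitrary lower neighbour, which exists by exchange towards
      \<open>B\<^sub>0\<close>; by \<open>down\<close> the choice does not affect the transported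
      value.\<close>
    define D where "D B = (SOME D. D \<in> \<B> \<and>
        (\<exists>x y. x \<in> B - B\<^sub>0 \<and> y \<in> B - B\<^sub>0 \<and> x \<noteq> y \<and> D = flip (flip B x) y))"
      for B
    have D: "D B \<in> \<B> \<and> (\<exists>x y. x \<in> B - B\<^sub>0 \<and> y \<in> B - B\<^sub>0 \<and> x \<noteq> y \<and> D B = flip (flip B x) y)"
      if B: "B \<in> \<B>" "d B = Suc k" for B
    proof -
      have "B - B\<^sub>0 \<noteq> {}" using B(2) unfolding d_def by force
      then obtain x where "x \<in> B - B\<^sub>0" by blast
      then obtain y where "y \<in> B" "y \<notin> B\<^sub>0" "y \<noteq> x" "flip (flip B x) y \<in> \<B>"
        using exchange[OF B(1) B0, of x] by blast
      with \<open>x \<in> B - B\<^sub>0\<close>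
      have "\<exists>D. D \<in> \<B> \<and> (\<exists>x y. x \<in> B - B\<^sub>0 \<and> y \<in> B - B\<^sub>0 \<and> x \<noteq> y \<and> D = flip (flip B x) y)"
        by (intro exI[of _ "flip (flip B x) y"] conjI exI[of _ x] exI[of _ y]) auto
      then show ?thesis unfolding D_def by (rule someI_ex)
    qed
    define g where "g B = (if d B = Suc k then f (D B) \<otimes> r (D B) B else f B)" for B
    have g_down: "g B = f (flip (flip B x) y) \<otimes> r (flip (flip B x) y) B"
      if "B \<in> \<B>" "d B = Suc k" "x \<in> B - B\<^sub>0" "y \<in> B - B\<^sub>0" "x \<noteq> y" "flip (flip B x) y \<in> \<B>" for B x y
      using D[OF that(1,2)] down[OF f that(1,2)] that unfolding g_def by metis
    have f_closed: "f B \<in> carrier G" if "B \<in> \<B>" for B using f that by (simp add: ok_def)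
    have g_closed: "g B \<in> carrier G" if B: "B \<in> \<B>" for B
    proof (cases "d B = Suc k")
      case True
      obtain x y where xy: "x \<in> B" "y \<in> B" "x \<noteq> y" "D B = flip (flip B x) y" "D B \<in> \<B>"
        using D[OF B True] by auto
      then have "r (D B) B \<in> carrier G"
        using r_closed[OF tr[OF B xy(1)] double_flip_adjacent[OF B xy(1-3)] basis_adjacent[OF B xy(1)]]
        by simp
      then show ?thesis using True xy f_closed by (simp add: g_def)
    qed (use f_closed B in \<open>simp add: g_def\<close>)
    \<comment> \<open>An edge from a lower level to the new one: both flipped elements of
      \<open>B'\<close> must lie outside \<open>B\<^sub>0\<close>, since otherwise the distance
      would not drop. Hence \<open>B\<close> may serve as the lower neighbour defining the value at
      \<open>B'\<close>.\<close>
    have up: "g B' = g B \<otimes> r B B'"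
      if T: "T \<in> transversals n" and B: "B \<in> adjacent_bases \<B> T" "B' \<in> adjacent_bases \<B> T"
        and d: "d B' = Suc k" "d B \<le> k" for T B B'
    proof -
      have "B \<noteq> B'" using d by auto
      then obtain x y where xy: "x \<in> B'" "y \<in> B'" "x \<noteq> y" "B = flip (flip B' x) y"
        using adjacent_bases_cases[OF T B(2,1)] by metis
      have "x \<notin> B\<^sub>0 \<and> y \<notin> B\<^sub>0"
        using double_flip_distance(2,3)[OF adj_in[OF B(2)] B0 xy(1-3)]
          double_flip_distance(3)[OF adj_in[OF B(2)] B0 xy(2,1)] xy(3,4) d
        by (auto simp: d_def flip_commute)
      then have "g B' = f B \<otimes> r B B'"
        using g_down[OF adj_in[OF B(2)] d(1), of x y] xy adj_in[OF B(1)] by simp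
      then show ?thesis using d by (simp add: g_def)
    qed
    have "g B' = g B \<otimes> r B B'"
      if T: "T \<in> transversals n" and B: "B \<in> adjacent_bases \<B> T" "B' \<in> adjacent_bases \<B> T"
        and d: "d B \<le> Suc k" "d B' \<le> Suc k" for T B B'
    proof -
      note bb = adj_in[OF B(1)] adj_in[OF B(2)]
      consider "d B \<le> k" "d B' \<le> k" | "d B' = Suc k" "d B \<le> k" | "d B = Suc k" "d B' \<le> k"
        | "d B = Suc k" "d B' = Suc k" using d by linarith
      then show ?thesis
      proof cases
        case 1
        then show ?thesis using okD[OF f T B] by (simp add: g_def)
      next
        case 2
        then show ?thesis using up T B by blast
      next
        case 3
        have "g B = g B' \<otimes> r B' B" using up[OF T B(2,1)] 3 by blast
        then show ?thesis
          using triangle[OF T B(2) B(1) B(2)] r_refl[OF T B(2)] r_closed[OF T B] r_closed[OF T B(2,1)]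
            g_closed[OF bb(2)] by (simp add: m_assoc)
      next
        case 4
        show ?thesis
        proof (cases "B = B'")
          case True
          then show ?thesis using r_refl[OF T B(1)] g_closed[OF bb(1)] by simp
        next
          case False
          then obtain x y where xy: "x \<in> B" "y \<in> B" "x \<noteq> y" "B' = flip (flip B x) y"
            using adjacent_bases_cases[OF T B] by metis
          have "\<exists>x y. x \<in> B \<and> y \<in> B \<and> x \<noteq> y \<and> B' = flip (flip B x) y \<and> x \<notin> B\<^sub>0 \<and> y \<in> B\<^sub>0"
          proof (cases "x \<in> B\<^sub>0")
            case True
            have "y \<notin> B\<^sub>0"
              using double_flip_distance(2)[OF bb(1) B0 xy(1-3) True] xy(4) 4 by (auto simp: d_def)
            with True show ?thesis using xy flip_commute by metis
          next
            case False
            have "y \<in> B\<^sub>0"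
              using double_flip_distance(1)[OF bb(1) B0 xy(1-3) False] xy(4) 4 by (auto simp: d_def)
            with False show ?thesis using xy by metis
          qed
          then obtain x y where xy: "x \<in> B" "y \<in> B" "x \<noteq> y" "B' = flip (flip B x) y" "x \<notin> B\<^sub>0" "y \<in> B\<^sub>0"
            by blast
          \<comment> \<open>For equal distances exactly one flipped element, named \<open>x\<close>,
            lies outside \<open>B\<^sub>0\<close>. Exchanging it towards \<open>B\<^sub>0\<close>
            gives a basis closer to \<open>B\<^sub>0\<close> in the clique of
            \<open>flip B x\<close>, which also contains \<open>B\<close> and \<open>B'\<close>; two
            instances of \<open>up\<close> and a triangle finish.\<close>
          obtain z where z: "z \<in> B" "z \<notin> B\<^sub>0" "z \<noteq> x" "flip (flip B x) z \<in> \<B>"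
            using exchange[OF bb(1) B0 xy(1,5)] by metis
          let ?D = "flip (flip B x) z" and ?T = "flip B x"
          have T': "?T \<in> transversals n" using tr bb xy by blast
          have n: "B \<in> adjacent_bases \<B> ?T" "B' \<in> adjacent_bases \<B> ?T" "?D \<in> adjacent_bases \<B> ?T"
            using basis_adjacent[OF bb(1) xy(1)] double_flip_adjacent[OF bb(1) xy(1-3)]
              double_flip_adjacent[OF bb(1) xy(1) z(1)] xy(4) z(3,4) bb(2) by simp_all
          have "card (B - B\<^sub>0) = card (?D - B\<^sub>0) + 2"
            using double_flip_distance(1)[OF bb(1) B0 xy(1) z(1)] z xy by auto
          then have dD: "d ?D \<le> k" using 4 by (simp add: d_def)
          have "g B = g ?D \<otimes> r ?D B" "g B' = g ?D \<otimes> r ?D B'"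
            using up[OF T' n(3,1)] up[OF T' n(3,2)] 4 dD by auto
          then show ?thesis
            using triangle[OF T' n(3,1,2)] r_closed[OF T' n(3,1)] r_closed[OF T' n(1,2)]
              g_closed[OF z(4)] by (simp add: m_assoc)
        qed
      qed
    qed
    with g_closed have "ok g (Suc k)" unfolding ok_def by blast
    then show ?case by blast
  qed
  \<comment> \<open>No distance between bases exceeds \<open>n\<close>, so at this level the
    distance bounds hold for all bases.\<close>
  then obtain f where f: "ok f n" by blast
  have "d B \<le> n" if "B \<in> \<B>" for B
    using basis_transversal[OF that] card_mono[of B "B - B\<^sub>0"] finite_transversal[of B n]
    by (auto simp: d_def transversals_def)
  then have "f B' = f B \<otimes> r B B'"
    if "T \<in> transversals n" "B \<in> adjacent_bases \<B> T" "B' \<in> adjacent_bases \<B> T" for T B B'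
    using okD[OF f that] adj_in that by blast
  with ok_closed[OF f] show ?thesis by (rule that)
qed

end

section \<open>Tracts with involution\<close>

lemma (in tract) neg_one_closed [simp]: "neg_one F \<in> carrier F"
  and neg_one_null: "{#\<one>, neg_one F#} \<in> null_set F"
  using theI'[OF unique_neg_one] by (auto simp: neg_one_def)

lemma (in tract) neg_one_unique: "a \<in> carrier F \<Longrightarrow> {#\<one>, a#} \<in> null_set F \<Longrightarrow> a = neg_one F"
  using unique_neg_one neg_one_closed neg_one_null by blast

text \<open>Scaling by the inverse of \<open>a\<close> normalizes the sum to one of the form
  \<open>1 + e\<close>, which forces \<open>e = -1\<close>. Null sums of two terms can therefore be
  solved for one term, although a tract has no addition.\<close>

lemma (in tract) two_term_null:
  assumes "a \<in> carrier F" "b \<in> carrier F" "{#a, b#} \<in> null_set F"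
  shows "b = neg_one F \<otimes> a"
proof -
  have "{#\<one>, inv a \<otimes> b#} \<in> null_set F"
    using null_set_scale[of "inv a", OF _ assms(3)] assms by simp
  then have "inv a \<otimes> b = neg_one F" using neg_one_unique assms by simp
  then show ?thesis using assms by (metis inv_solve_left m_comm neg_one_closed)
qed

lemma (in tract) neg_one_square: "neg_one F \<otimes> neg_one F = \<one>"
  using two_term_null[of "neg_one F" \<one>] neg_one_null by (simp add: add_mset_commute)

lemma (in tract) neg_one_pow: "neg_one F [^] (k::nat) = (if even k then \<one> else neg_one F)"
  by (induction k) (auto simp: neg_one_square)

lemma tmult_eq_None_iff [simp]: "tmult F x y = None \<longleftrightarrow> x = None \<or> y = None"
  by (cases x; cases y) auto

lemma tmult_None_right [simp]: "tmult F x None = None"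
  by simp

lemma alt_sign_eq_None_iff [simp]: "alt_sign F k x = None \<longleftrightarrow> x = None"
  by (simp add: alt_sign_def)

lemma alt_sign_None [simp]: "alt_sign F k None = None"
  by (simp add: alt_sign_def)

lemma None_in_elts [simp]: "None \<in> elts F"
  and Some_in_elts [simp]: "Some a \<in> elts F \<longleftrightarrow> a \<in> carrier F"
  by (auto simp: elts_def)

context tract
begin

lemma tmult_closed: "x \<in> elts F \<Longrightarrow> y \<in> elts F \<Longrightarrow> tmult F x y \<in> elts F"
  by (cases x; cases y) auto

lemma tmult_assoc:
  "x \<in> elts F \<Longrightarrow> y \<in> elts F \<Longrightarrow> z \<in> elts F \<Longrightarrow> tmult F (tmult F x y) z = tmult F x (tmult F y z)"
  by (cases x; cases y; cases z) (auto simp: m_assoc)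

lemma tmult_one: "x \<in> elts F \<Longrightarrow> tmult F (Some \<one>) x = x"
  by (cases x) auto

lemma alt_sign_closed: "x \<in> elts F \<Longrightarrow> alt_sign F k x \<in> elts F"
  unfolding alt_sign_def by (intro tmult_closed) auto

lemma alt_sign_Some: "alt_sign F k (Some a) = Some (neg_one F [^] k \<otimes> a)"
  by (simp add: alt_sign_def)

lemma alt_sign_parity: "even k \<longleftrightarrow> even l \<Longrightarrow> alt_sign F k x = alt_sign F l x"
  by (simp add: alt_sign_def neg_one_pow)

lemma alt_sign_tmult:
  assumes "x \<in> elts F" "y \<in> elts F"
  shows "tmult F (alt_sign F k x) (alt_sign F l y) = alt_sign F (k + l) (tmult F x y)"
  using assms by (cases x; cases y) (auto simp: alt_sign_Some nat_pow_mult[symmetric] m_ac)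

lemma alt_sign_scale:
  assumes "a \<in> carrier F" "x \<in> elts F"
  shows "alt_sign F k (tmult F (Some a) x) = tmult F (Some a) (alt_sign F k x)"
  using assms by (cases x) (auto simp: alt_sign_Some m_ac)

end

locale tract_with_involution = tract F for F (structure) +
  fixes c :: "'a \<Rightarrow> 'a"
  assumes involution: "tract_involution F c"
begin

lemma conj_hom: "c \<in> hom F F"
  and conj_null: "a \<in> null_set F \<Longrightarrow> image_mset c a \<in> null_set F"
  and conj_conj [simp]: "x \<in> carrier F \<Longrightarrow> c (c x) = x"
  using involution by (auto simp: tract_involution_def tract_hom_def)

lemma conj_closed [simp]: "x \<in> carrier F \<Longrightarrow> c x \<in> carrier F"
  using conj_hom by (rule hom_in_carrier)

lemma conj_mult [simp]: "x \<in> carrier F \<Longrightarrow> y \<in> carrier F \<Longrightarrow> c (x \<otimes> y) = c x \<otimes> c y"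
  using conj_hom by (rule hom_mult)

lemma conj_one [simp]: "c \<one> = \<one>"
  using conj_hom hom_one is_group by blast

lemma conj_neg_one [simp]: "c (neg_one F) = neg_one F"
  using conj_null[OF neg_one_null] by (intro neg_one_unique) auto

lemma conj_elts: "x \<in> elts F \<Longrightarrow> map_option c x \<in> elts F"
  by (cases x) auto

lemma map_option_conj_conj: "x \<in> elts F \<Longrightarrow> map_option c (map_option c x) = x"
  by (cases x) auto

lemma map_option_conj_alt_sign:
  "x \<in> elts F \<Longrightarrow> map_option c (alt_sign F k x) = alt_sign F k (map_option c x)"
  by (cases x) (auto simp: alt_sign_Some neg_one_pow)

end

text \<open>
  In terms of untwisted vectors, scalars act coordinatewise and the inner product of \<open>X\<close>
  with the star of \<open>Y\<close> involves no conjugation.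
\<close>

definition untwist :: "('a \<Rightarrow> 'a) \<Rightarrow> (int \<Rightarrow> 'a option) \<Rightarrow> int \<Rightarrow> 'a option" where
  "untwist c X = (\<lambda>i. if 0 < i then X i else map_option c (X i))"

lemma supp_untwist [simp]: "supp (untwist c X) = supp X"
  by (auto simp: supp_def untwist_def)

lemma untwist_eq_None_iff [simp]: "untwist c X i = None \<longleftrightarrow> X i = None"
  by (auto simp: untwist_def)

lemma supp_scale [simp]: "supp (scale F c \<alpha> X) = supp X"
  by (auto simp: supp_def scale_def)

lemma vectors_elts: "X \<in> vectors F n \<Longrightarrow> X i \<in> elts F"
  by (cases "i \<in> ground n") (auto simp: vectors_def)

lemma vectorsI: "(\<And>i. X i \<in> elts F) \<Longrightarrow> supp X \<subseteq> ground n \<Longrightarrow> X \<in> vectors F n"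
  by (auto simp: vectors_def supp_def)

lemma vectors_supp: "X \<in> vectors F n \<Longrightarrow> supp X \<subseteq> ground n"
  by (auto simp: vectors_def supp_def)

context tract_with_involution
begin

lemma untwist_elts: "X \<in> vectors F n \<Longrightarrow> untwist c X i \<in> elts F"
  by (simp add: untwist_def vectors_elts conj_elts)

lemma untwist_inject:
  assumes "X \<in> vectors F n" "Y \<in> vectors F n" "\<And>i. untwist c X i = untwist c Y i"
  shows "X = Y"
proof
  fix i
  have "X i = Y i" if "map_option c (X i) = map_option c (Y i)"
    using arg_cong[OF that, of "map_option c"]
    by (simp only: map_option_conj_conj[OF vectors_elts[OF assms(1)]]
        map_option_conj_conj[OF vectors_elts[OF assms(2)]])
  then show "X i = Y i" using assms(3)[of i] by (simp add: untwist_def split: if_splits)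
qed

lemma scale_closed:
  assumes "X \<in> vectors F n" "\<alpha> \<in> carrier F"
  shows "scale F c \<alpha> X \<in> vectors F n"
proof (rule vectorsI)
  show "scale F c \<alpha> X i \<in> elts F" for i
    using assms vectors_elts[OF assms(1), of i] by (auto simp: scale_def intro!: tmult_closed)
qed (simp add: vectors_supp[OF assms(1)])

lemma untwist_scale:
  assumes "X \<in> vectors F n" "\<alpha> \<in> carrier F"
  shows "untwist c (scale F c \<alpha> X) i = tmult F (Some \<alpha>) (untwist c X i)"
  using assms vectors_elts[OF assms(1), of i] by (cases "X i") (auto simp: untwist_def scale_def)

lemma scale_scale:
  assumes "X \<in> vectors F n" "\<alpha> \<in> carrier F" "\<beta> \<in> carrier F"
  shows "scale F c \<alpha> (scale F c \<beta> X) = scale F c (\<alpha> \<otimes> \<beta>) X"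
proof (rule untwist_inject[where n = n])
  fix i
  show "untwist c (scale F c \<alpha> (scale F c \<beta> X)) i = untwist c (scale F c (\<alpha> \<otimes> \<beta>) X) i"
    using tmult_assoc[of "Some \<alpha>" "Some \<beta>" "untwist c X i"] untwist_elts[OF assms(1)] assms
    by (simp add: untwist_scale[where n = n] scale_closed)
qed (use assms in \<open>simp_all add: scale_closed\<close>)

lemma scale_one: "X \<in> vectors F n \<Longrightarrow> scale F c \<one> X = X"
  by (rule untwist_inject[where n = n])
     (simp_all add: scale_closed untwist_scale[where n = n] untwist_elts[where n = n] tmult_one)

text \<open>The index \<open>i\<close> pairs \<open>X i\<close> with the conjugate of
  \<open>Y (- i)\<close>, and \<open>- i\<close> pairs the conjugate of \<open>X (- i)\<close> with
  \<open>Y i\<close>. Both are the same untwisted product, so the two summands for each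
  \<open>i\<close> merge into one sum over the ground set.\<close>

lemma inner_product_star:
  assumes "X \<in> vectors F n" "Y \<in> vectors F n"
  shows "inner_product F c n X (star Y) =
    (\<Sum>i \<in> ground n. formal (tmult F (untwist c X i) (untwist c Y (- i))))"
proof -
  let ?g = "\<lambda>i. formal (tmult F (untwist c X i) (untwist c Y (- i)))"
  have "sum ?g (ground n) = sum ?g {1..int n} + sum ?g (uminus ` {1..int n})"
    unfolding ground_def by (intro sum.union_disjoint) auto
  also have "sum ?g (uminus ` {1..int n}) = (\<Sum>i \<in> {1..int n}. ?g (- i))"
    by (subst sum.reindex) (auto simp: inj_on_def)
  also have "sum ?g {1..int n} + (\<Sum>i \<in> {1..int n}. ?g (- i)) = inner_product F c n X (star Y)"
    unfolding inner_product_def star_def sum.distrib[symmetric]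
    by (intro sum.cong) (auto simp: untwist_def)
  finally show ?thesis by simp
qed

end

section \<open>Circuit vectors and Wick sums\<close>

lemma even_card_sym_diff:
  assumes "finite A" "finite B"
  shows "even (card (sym_diff A B)) \<longleftrightarrow> even (card A + card B)"
proof -
  have "card A = card (A - B) + card (A \<inter> B)" "card B = card (B - A) + card (A \<inter> B)"
    using assms by (metis card_Diff_subset_Int card_Int_Diff add.commute finite_Int inf_commute)+
  moreover have "card (sym_diff A B) = card (A - B) + card (B - A)"
    using assms by (intro card_Un_disjoint) auto
  ultimately show ?thesis by presburger
qed

text \<open>Counting from one, the index of an element in the sorted list is its rank in the set.
  This lets signs given by list positions be computed from cardinalities.\<close>

lemma sorted_list_of_set_indexing:
  fixes S :: "'b::linorder set"
  assumes "finite S"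
  defines "xs \<equiv> sorted_list_of_set S"
  shows "bij_betw (\<lambda>k. xs ! (k - 1)) {1..length xs} S"
    and "k \<in> {1..length xs} \<Longrightarrow> card (S \<inter> {..xs ! (k - 1)}) = k"
proof -
  have xs: "set xs = S" "sorted_wrt (<) xs" "distinct xs" using assms by auto
  have b: "bij_betw (\<lambda>k. k - 1) {1..length xs} {..<length xs}"
    by (rule bij_betwI[where g = Suc]) auto
  show "bij_betw (\<lambda>k. xs ! (k - 1)) {1..length xs} S"
    using bij_betw_trans[OF b bij_betw_nth[OF xs(3) refl xs(1)[symmetric]]] by (simp add: o_def)
  show "card (S \<inter> {..xs ! (k - 1)}) = k" if k: "k \<in> {1..length xs}"
  proof -
    have "xs ! i \<le> xs ! (k - 1) \<longleftrightarrow> i < k" if "i < length xs" for i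
    proof (cases "i < k")
      case True
      then have "xs ! i \<le> xs ! (k - 1)"
        using k sorted_nth_mono[of xs i "k - 1"] by (simp add: xs_def)
      then show ?thesis using True by simp
    next
      case False
      then have "xs ! (k - 1) < xs ! i"
        using k that xs(2) by (simp add: sorted_wrt_iff_nth_less)
      then show ?thesis using False by simp
    qed
    then have "S \<inter> {..xs ! (k - 1)} = (!) xs ` {..<k}"
      using k unfolding xs(1)[symmetric] set_conv_nth by (auto simp: image_iff)
    moreover have "inj_on ((!) xs) {..<k}" using xs(3) k by (auto simp: inj_on_def nth_eq_iff_index_eq)
    ultimately show ?thesis by (simp add: card_image)
  qed
qed

lemma (in tract) wick_sum_indexing:
  fixes S :: "int set"
  assumes "finite S" "S \<subseteq> {1..}"
  defines "xs \<equiv> sorted_list_of_set S"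
  shows "(\<Sum>k = 1..length xs. formal (alt_sign F k (h (xs ! (k - 1))))) =
      (\<Sum>i \<in> S. formal (alt_sign F (card (S \<inter> {1..i})) (h i)))"
    and "card {k \<in> {1..length xs}. h (xs ! (k - 1)) \<noteq> None} = card {i \<in> S. h i \<noteq> None}"
proof -
  note b = sorted_list_of_set_indexing[OF assms(1), folded xs_def]
  have S: "S \<inter> {1..i} = S \<inter> {..i}" for i using assms(2) by auto
  show "(\<Sum>k = 1..length xs. formal (alt_sign F k (h (xs ! (k - 1))))) =
      (\<Sum>i \<in> S. formal (alt_sign F (card (S \<inter> {1..i})) (h i)))"
    unfolding S by (rule sum.reindex_bij_betw[OF b(1), THEN subst]) (intro sum.cong refl; simp only: b(2))
  have "bij_betw (\<lambda>k. xs ! (k - 1)) {k \<in> {1..length xs}. h (xs ! (k - 1)) \<noteq> None} {i \<in> S. h i \<noteq> None}"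
    by (rule bij_betw_Collect[OF b(1)]) simp
  then show "card {k \<in> {1..length xs}. h (xs ! (k - 1)) \<noteq> None} = card {i \<in> S. h i \<noteq> None}"
    by (rule bij_betw_same_card)
qed

text \<open>The first condition ranges over all sets: outside the transversals the value is zero,
  which belongs to \<open>elts F\<close>. This spares membership conditions when values at flips are
  manipulated.\<close>

definition transversal_function :: "('a, 'm) tract_scheme \<Rightarrow> nat \<Rightarrow> (int set \<Rightarrow> 'a option) \<Rightarrow> bool" where
  "transversal_function F n \<phi> \<longleftrightarrow>
     (\<forall>T. \<phi> T \<in> elts F) \<and> (\<forall>T. T \<notin> transversals n \<longrightarrow> \<phi> T = None)"

definition bases_of :: "(int set \<Rightarrow> 'a option) \<Rightarrow> int set set" where
  "bases_of \<phi> = {T. \<phi> T \<noteq> None}"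

context tract_with_involution
begin

text \<open>The conjugation built into \<open>circuit_vector\<close> on negative coordinates cancels
  against that of \<open>untwist\<close>; the sign is unaffected because the involution fixes
  -1.\<close>

lemma untwist_circuit_vector:
  assumes "transversal_function F n \<phi>" "T \<in> transversals n"
  shows "untwist c (circuit_vector F c \<phi> T) x =
    (if x \<in> T then alt_sign F (card (T \<inter> {1..\<bar>x\<bar>})) (\<phi> (flip T x)) else None)"
proof -
  have "\<phi> (flip T x) \<in> elts F" using assms by (simp add: transversal_function_def)
  then show ?thesis
    by (auto simp: untwist_def circuit_vector_def map_option_conj_alt_sign conj_elts map_option_conj_conj)
qed

lemma supp_circuit_vector: "supp (circuit_vector F c \<phi> T) = fund_circuit (bases_of \<phi>) T"
proof (rule Set.set_eqI)
  show "x \<in> supp (circuit_vector F c \<phi> T) \<longleftrightarrow> x \<in> fund_circuit (bases_of \<phi>) T" for x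
    by (simp add: supp_def circuit_vector_def fund_circuit_def bases_of_def del: not_None_eq)
qed

lemma circuit_vector_closed:
  assumes "transversal_function F n \<phi>" "T \<in> transversals n"
  shows "circuit_vector F c \<phi> T \<in> vectors F n"
proof (rule vectorsI)
  have "\<phi> (flip T i) \<in> elts F" for i using assms by (simp add: transversal_function_def)
  then show "circuit_vector F c \<phi> T i \<in> elts F" for i
    by (auto simp: circuit_vector_def intro: alt_sign_closed conj_elts)
  show "supp (circuit_vector F c \<phi> T) \<subseteq> ground n"
    using assms by (auto simp: supp_circuit_vector fund_circuit_def transversal_iff)
qed

text \<open>Elements common to both transversals are counted twice. So the product of the position
  signs of two circuit vectors is the sign of the rank in the symmetric difference, as in the Wick
  sum.\<close>

lemma even_card_position:
  assumes "T\<^sub>1 \<in> transversals n" "T\<^sub>2 \<in> transversals n"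
  shows "even (card (T\<^sub>1 \<inter> {1..i}) + card (T\<^sub>2 \<inter> {1..i})) \<longleftrightarrow> even (card (sym_diff T\<^sub>1 T\<^sub>2 \<inter> {1..i}))"
proof -
  have "sym_diff T\<^sub>1 T\<^sub>2 \<inter> {1..i} = sym_diff (T\<^sub>1 \<inter> {1..i}) (T\<^sub>2 \<inter> {1..i})" by auto
  then show ?thesis using even_card_sym_diff[of "T\<^sub>1 \<inter> {1..i}" "T\<^sub>2 \<inter> {1..i}"] by simp
qed

text \<open>A coordinate contributes only if \<open>x \<in> T\<^sub>1\<close> and
  \<open>- x \<in> T\<^sub>2\<close>, that is, on \<open>T\<^sub>1 - T\<^sub>2\<close>. Absolute
  values identify this set with the index set of the Wick sum, and the signs agree by
  \<open>even_card_position\<close>. The second part matches the two versions of the bound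
  four.\<close>

lemma inner_product_circuit_vectors:
  assumes \<phi>: "transversal_function F n \<phi>" and T: "T\<^sub>1 \<in> transversals n" "T\<^sub>2 \<in> transversals n"
  defines "xs \<equiv> sorted_list_of_set (sym_diff T\<^sub>1 T\<^sub>2 \<inter> {1..int n})"
  shows "inner_product F c n (circuit_vector F c \<phi> T\<^sub>1) (star (circuit_vector F c \<phi> T\<^sub>2)) =
      (\<Sum>k = 1..length xs. formal (alt_sign F k (wick_product F \<phi> T\<^sub>1 T\<^sub>2 (xs ! (k - 1)))))"
    and "card (supp (circuit_vector F c \<phi> T\<^sub>1) \<inter> uminus ` supp (circuit_vector F c \<phi> T\<^sub>2)) =
      card {k \<in> {1..length xs}. wick_product F \<phi> T\<^sub>1 T\<^sub>2 (xs ! (k - 1)) \<noteq> None}"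
proof -
  let ?S = "sym_diff T\<^sub>1 T\<^sub>2 \<inter> {1..int n}" and ?w = "wick_product F \<phi> T\<^sub>1 T\<^sub>2"
  have S: "finite ?S" "?S \<subseteq> {1..}" by auto
  have e: "\<phi> T \<in> elts F" for T using \<phi> by (simp add: transversal_function_def)
  have w_uminus: "?w (- x) = ?w x" for x by (simp add: wick_product_def)
  \<comment> \<open>The inverse takes whichever of \<open>i\<close> and \<open>- i\<close> belongs
    to \<open>T\<^sub>1\<close>; it is outside \<open>T\<^sub>2\<close> because \<open>i\<close>
    separates the two transversals.\<close>
  have bij: "bij_betw abs (T\<^sub>1 - T\<^sub>2) ?S"
  proof (rule bij_betwI[where g = "\<lambda>i. if i \<in> T\<^sub>1 then i else - i"])
    have mem: "- x \<in> T\<^sub>1 \<longleftrightarrow> x \<notin> T\<^sub>1" "- x \<in> T\<^sub>2 \<longleftrightarrow> x \<notin> T\<^sub>2" if "x \<in> ground n" for x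
      using that T by (auto simp: transversal_iff)
    have gr: "x \<in> ground n" if "x \<in> T\<^sub>1" for x using that T by (auto simp: transversal_iff)
    show "abs \<in> T\<^sub>1 - T\<^sub>2 \<rightarrow> ?S"
    proof
      fix x assume x: "x \<in> T\<^sub>1 - T\<^sub>2"
      then show "\<bar>x\<bar> \<in> ?S"
        using mem[of x] gr[of x] by (cases "0 < x") (auto simp: ground_iff)
    qed
    show "(\<lambda>i. if i \<in> T\<^sub>1 then i else - i) \<in> ?S \<rightarrow> T\<^sub>1 - T\<^sub>2"
    proof
      fix i assume i: "i \<in> ?S"
      then have "i \<in> ground n" by (simp add: ground_iff)
      with mem i show "(if i \<in> T\<^sub>1 then i else - i) \<in> T\<^sub>1 - T\<^sub>2" by auto
    qed
    show "(if \<bar>x\<bar> \<in> T\<^sub>1 then \<bar>x\<bar> else - \<bar>x\<bar>) = x" if "x \<in> T\<^sub>1 - T\<^sub>2" for x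
      using that mem[of x] gr[of x] by (cases "0 < x") (auto simp: abs_if)
  qed (use S in auto)
  let ?f = "\<lambda>i. tmult F (untwist c (circuit_vector F c \<phi> T\<^sub>1) i)
      (untwist c (circuit_vector F c \<phi> T\<^sub>2) (- i))"
  have "inner_product F c n (circuit_vector F c \<phi> T\<^sub>1) (star (circuit_vector F c \<phi> T\<^sub>2)) =
      (\<Sum>i \<in> ground n. formal (?f i))"
    using circuit_vector_closed[OF \<phi>] T by (intro inner_product_star) auto
  also have "\<dots> = (\<Sum>i \<in> T\<^sub>1 - T\<^sub>2. formal (?f i))"
    using T by (intro sum.mono_neutral_right)
      (auto simp: untwist_circuit_vector[OF \<phi>] transversal_iff)
  also have "\<dots> = (\<Sum>i \<in> T\<^sub>1 - T\<^sub>2. formal (alt_sign F (card (?S \<inter> {1..\<bar>i\<bar>})) (?w \<bar>i\<bar>)))"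
  proof (intro sum.cong refl)
    fix i assume i: "i \<in> T\<^sub>1 - T\<^sub>2"
    then have g: "i \<in> T\<^sub>1" "- i \<in> T\<^sub>2" "\<bar>i\<bar> \<le> int n" using T by (auto simp: transversal_iff ground_iff)
    then have "?S \<inter> {1..\<bar>i\<bar>} = sym_diff T\<^sub>1 T\<^sub>2 \<inter> {1..\<bar>i\<bar>}" by auto
    then have par: "even (card (T\<^sub>1 \<inter> {1..\<bar>i\<bar>}) + card (T\<^sub>2 \<inter> {1..\<bar>i\<bar>})) \<longleftrightarrow> even (card (?S \<inter> {1..\<bar>i\<bar>}))"
      using even_card_position[OF T] by simp
    have "?f i = alt_sign F (card (T\<^sub>1 \<inter> {1..\<bar>i\<bar>}) + card (T\<^sub>2 \<inter> {1..\<bar>i\<bar>})) (?w i)"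
      using g e by (simp add: untwist_circuit_vector[OF \<phi>] T alt_sign_tmult wick_product_def)
    also have "\<dots> = alt_sign F (card (?S \<inter> {1..\<bar>i\<bar>})) (?w \<bar>i\<bar>)"
      using alt_sign_parity[OF par] w_uminus[of i] by (simp add: abs_if)
    finally show "formal (?f i) = formal (alt_sign F (card (?S \<inter> {1..\<bar>i\<bar>})) (?w \<bar>i\<bar>))" by simp
  qed
  also have "\<dots> = (\<Sum>i \<in> ?S. formal (alt_sign F (card (?S \<inter> {1..i})) (?w i)))"
    by (rule sum.reindex_bij_betw[OF bij])
  also have "\<dots> = (\<Sum>k = 1..length xs. formal (alt_sign F k (?w (xs ! (k - 1)))))"
    unfolding xs_def by (rule wick_sum_indexing(1)[OF S, symmetric])
  finally show "inner_product F c n (circuit_vector F c \<phi> T\<^sub>1) (star (circuit_vector F c \<phi> T\<^sub>2)) =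
      (\<Sum>k = 1..length xs. formal (alt_sign F k (?w (xs ! (k - 1)))))" .
  have "supp (circuit_vector F c \<phi> T\<^sub>1) \<inter> uminus ` supp (circuit_vector F c \<phi> T\<^sub>2) =
      {x \<in> T\<^sub>1 - T\<^sub>2. ?w \<bar>x\<bar> \<noteq> None}" (is "?A = _")
  proof (rule Set.set_eqI)
    fix x
    have "?w \<bar>x\<bar> = ?w x" using w_uminus[of x] by (simp add: abs_if)
    then have "?w \<bar>x\<bar> \<noteq> None \<longleftrightarrow> \<phi> (flip T\<^sub>1 x) \<noteq> None \<and> \<phi> (flip T\<^sub>2 x) \<noteq> None"
      by (simp add: wick_product_def del: not_None_eq)
    moreover have "x \<in> uminus ` supp (circuit_vector F c \<phi> T\<^sub>2) \<longleftrightarrow> - x \<in> T\<^sub>2 \<and> \<phi> (flip T\<^sub>2 x) \<noteq> None"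
      by (simp add: mem_uminus_image supp_circuit_vector fund_circuit_def bases_of_def del: not_None_eq)
    moreover have "x \<in> supp (circuit_vector F c \<phi> T\<^sub>1) \<longleftrightarrow> x \<in> T\<^sub>1 \<and> \<phi> (flip T\<^sub>1 x) \<noteq> None"
      by (simp add: supp_circuit_vector fund_circuit_def bases_of_def del: not_None_eq)
    moreover have "x \<in> T\<^sub>1 \<Longrightarrow> - x \<in> T\<^sub>2 \<longleftrightarrow> x \<notin> T\<^sub>2" using T by (auto simp: transversal_iff)
    ultimately show "x \<in> ?A \<longleftrightarrow> x \<in> {x \<in> T\<^sub>1 - T\<^sub>2. ?w \<bar>x\<bar> \<noteq> None}"
      by blast
  qed
  also have "card \<dots> = card {i \<in> ?S. ?w i \<noteq> None}"
  proof (rule bij_betw_same_card)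
    show "bij_betw abs {x \<in> T\<^sub>1 - T\<^sub>2. ?w \<bar>x\<bar> \<noteq> None} {i \<in> ?S. ?w i \<noteq> None}"
      by (rule bij_betw_Collect[OF bij]) simp
  qed
  also have "\<dots> = card {k \<in> {1..length xs}. ?w (xs ! (k - 1)) \<noteq> None}"
    unfolding xs_def by (rule wick_sum_indexing(2)[OF S, symmetric])
  finally show "card (supp (circuit_vector F c \<phi> T\<^sub>1) \<inter> uminus ` supp (circuit_vector F c \<phi> T\<^sub>2)) =
      card {k \<in> {1..length xs}. ?w (xs ! (k - 1)) \<noteq> None}" .
qed

text \<open>Both the Wick relations and the condition selecting them translate into orthogonality of
  circuit vectors, so Wick functions and weak signatures can be compared in the same
  language.\<close>

lemma mw_wick_function_iff:
  "mw_wick_function F n \<phi> \<longleftrightarrow>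
     transversal_function F n \<phi> \<and> orthogonal_matroid n (bases_of \<phi>) \<and>
     (\<forall>T\<^sub>1 \<in> transversals n. \<forall>T\<^sub>2 \<in> transversals n.
        card (supp (circuit_vector F c \<phi> T\<^sub>1) \<inter> uminus ` supp (circuit_vector F c \<phi> T\<^sub>2)) \<le> 4 \<longrightarrow>
        inner_product F c n (circuit_vector F c \<phi> T\<^sub>1) (star (circuit_vector F c \<phi> T\<^sub>2)) \<in> null_set F)"
proof (cases "transversal_function F n \<phi>")
  case True
  then have b: "{T \<in> transversals n. \<phi> T \<noteq> None} = bases_of \<phi>"
    by (auto simp: bases_of_def transversal_function_def)
  have ne: "\<exists>T \<in> transversals n. \<phi> T \<noteq> None" if "orthogonal_matroid n (bases_of \<phi>)"
    using that unfolding b[symmetric] by (auto simp: orthogonal_matroid_def)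
  have "(\<forall>T \<in> transversals n. \<phi> T \<in> elts F) \<and> (\<forall>T. T \<notin> transversals n \<longrightarrow> \<phi> T = None)"
    using True by (auto simp: transversal_function_def)
  then show ?thesis
    unfolding mw_wick_function_def Let_def b
    using True ne by (simp add: inner_product_circuit_vectors cong: ball_cong) blast
next
  case False
  then have "\<not> ((\<forall>T \<in> transversals n. \<phi> T \<in> elts F) \<and> (\<forall>T. T \<notin> transversals n \<longrightarrow> \<phi> T = None))"
    unfolding transversal_function_def by (metis None_in_elts)
  then show ?thesis unfolding mw_wick_function_def using False by blast
qed

end

section \<open>Two-element intersections of circuits and connectedness of the bases\<close>

context matroid_bases
begin

lemma fund_circuit_Int:
  assumes "T\<^sub>1 \<in> transversals n" "T\<^sub>2 \<in> transversals n"
  shows "fund_circuit \<B> T\<^sub>1 \<inter> uminus ` fund_circuit \<B> T\<^sub>2 =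
    {x \<in> T\<^sub>1 - T\<^sub>2. flip T\<^sub>1 x \<in> \<B> \<and> flip T\<^sub>2 x \<in> \<B>}"
proof (rule Set.set_eqI)
  fix x
  have "x \<in> T\<^sub>1 \<Longrightarrow> - x \<in> T\<^sub>2 \<longleftrightarrow> x \<notin> T\<^sub>2" using assms by (auto simp: transversal_iff)
  then show "x \<in> fund_circuit \<B> T\<^sub>1 \<inter> uminus ` fund_circuit \<B> T\<^sub>2 \<longleftrightarrow>
      x \<in> {x \<in> T\<^sub>1 - T\<^sub>2. flip T\<^sub>1 x \<in> \<B> \<and> flip T\<^sub>2 x \<in> \<B>}"
    by (simp only: mem_uminus_image Int_iff) (auto simp: fund_circuit_def)
qed

text \<open>\<open>T\<close> and its double flip are each one flip away from the same two bases,
  with the roles of \<open>x\<close> and \<open>y\<close> interchanged, and they differ only in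
  those two pairs. This is the basic source of relations with two terms.\<close>

lemma double_flip_fund_circuit:
  assumes T: "T \<in> transversals n" and xy: "x \<in> fund_circuit \<B> T" "y \<in> fund_circuit \<B> T" "x \<noteq> y"
  shows "flip (flip T x) y \<in> transversals n"
    and "- x \<in> fund_circuit \<B> (flip (flip T x) y)" "- y \<in> fund_circuit \<B> (flip (flip T x) y)"
    and "fund_circuit \<B> T \<inter> uminus ` fund_circuit \<B> (flip (flip T x) y) = {x, y}"
proof -
  let ?T' = "flip (flip T x) y"
  have m: "x \<in> T" "y \<in> T" "flip T x \<in> \<B>" "flip T y \<in> \<B>" using xy by (auto simp: fund_circuit_def)
  have n: "- x \<notin> T" "- y \<notin> T" "x \<noteq> - y" "y \<noteq> - x" using transversal_uminus[OF T] m by auto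
  have g: "x \<in> ground n" "y \<in> ground n" using T m by (auto simp: transversal_iff)
  show T': "?T' \<in> transversals n" using T g by (simp add: transversal_flip)
  have f: "flip ?T' x = flip T y" "flip ?T' y = flip T x"
    by (subst flip_commute[of T x y], simp) simp
  have "- x \<in> ?T'" "- y \<in> ?T'" using n xy(3) by (auto simp: flip_iff)
  then show c: "- x \<in> fund_circuit \<B> ?T'" "- y \<in> fund_circuit \<B> ?T'"
    using f m by (auto simp: fund_circuit_def)
  have "T - ?T' = {x, y}" using m n xy(3) by (auto simp: flip_iff split: if_splits)
  then show "fund_circuit \<B> T \<inter> uminus ` fund_circuit \<B> ?T' = {x, y}"
    unfolding fund_circuit_Int[OF T T'] using f m by auto
qed

text \<open>Exchange towards \<open>B\<^sub>0\<close> lowers the distance by two and stays within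
  one clique, so a property inherited inside cliques spreads from \<open>B\<^sub>0\<close> to every
  basis.\<close>

lemma bases_connected:
  assumes "B\<^sub>0 \<in> \<B>" "B \<in> \<B>" "P B\<^sub>0"
    and step: "\<And>T B B'. T \<in> transversals n \<Longrightarrow> B \<in> adjacent_bases \<B> T \<Longrightarrow>
      B' \<in> adjacent_bases \<B> T \<Longrightarrow> P B \<Longrightarrow> P B'"
  shows "P B"
  using assms(2)
proof (induction "card (B - B\<^sub>0)" arbitrary: B rule: less_induct)
  case less
  show ?case
  proof (cases "B = B\<^sub>0")
    case False
    then obtain x where x: "x \<in> B" "x \<notin> B\<^sub>0"
      using transversal_eqI[of B n B\<^sub>0] basis_transversal assms(1) less.prems by blast
    obtain y where y: "y \<in> B" "y \<notin> B\<^sub>0" "y \<noteq> x" "flip (flip B x) y \<in> \<B>"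
      using exchange[OF less.prems assms(1) x] by metis
    have "card (flip (flip B x) y - B\<^sub>0) < card (B - B\<^sub>0)"
      using double_flip_distance(1)[OF less.prems assms(1) x(1) y(1)] x y by simp
    then have "P (flip (flip B x) y)" using less.hyps y(4) by blast
    moreover have "flip B x \<in> transversals n"
      using transversal_flip basis_transversal[OF less.prems] transversal_subset_ground x by metis
    ultimately show ?thesis
      using step[of "flip B x" "flip (flip B x) y" B] basis_adjacent[OF less.prems x(1)]
        double_flip_adjacent[OF less.prems x(1) y(1)] y by simp
  qed (use assms(3) in simp)
qed

end

section \<open>From a Wick function to a weak signature\<close>

context tract_with_involution
begin

text \<open>In untwisted form both scalars act by plain multiplication, so they leave the sum as a
  single factor and nullity is preserved.\<close>

lemma inner_product_scale:
  assumes XY: "X \<in> vectors F n" "Y \<in> vectors F n" and ab: "\<alpha> \<in> carrier F" "\<beta> \<in> carrier F"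
  shows "inner_product F c n (scale F c \<alpha> X) (star (scale F c \<beta> Y)) =
    image_mset (\<lambda>x. (\<alpha> \<otimes> \<beta>) \<otimes> x) (inner_product F c n X (star Y))"
proof -
  have im: "image_mset h (sum g A) = (\<Sum>i \<in> A. image_mset h (g i))"
    for h :: "'a \<Rightarrow> 'a" and g :: "int \<Rightarrow> 'a multiset" and A
    by (induction A rule: infinite_finite_induct) auto
  have "formal (tmult F (tmult F (Some \<alpha>) x) (tmult F (Some \<beta>) y)) =
      image_mset (\<lambda>x. (\<alpha> \<otimes> \<beta>) \<otimes> x) (formal (tmult F x y))"
    if "x \<in> elts F" "y \<in> elts F" for x y
    using that ab by (cases x; cases y) (auto simp: m_ac)
  then show ?thesis
    using XY ab by (simp add: inner_product_star scale_closed untwist_scale[where n = n]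
        untwist_elts[where n = n] im)
qed

lemma inner_product_zero:
  assumes "X \<in> vectors F n" "Y \<in> vectors F n" "supp X = {} \<or> supp Y = {}"
  shows "inner_product F c n X (star Y) = {#}"
proof -
  have "tmult F (untwist c X i) (untwist c Y (- i)) = None" for i
    using assms(3) unfolding supp_def tmult_eq_None_iff untwist_eq_None_iff by blast
  then have "formal (tmult F (untwist c X i) (untwist c Y (- i))) = {#}" for i
    by (simp only: formal.simps)
  then show ?thesis using assms(1,2) by (simp add: inner_product_star)
qed

lemma circuit_vector_scale:
  assumes \<phi>: "transversal_function F n \<phi>" and a: "\<alpha> \<in> carrier F" and T: "T \<in> transversals n"
  shows "circuit_vector F c (\<lambda>T. tmult F (Some \<alpha>) (\<phi> T)) T = scale F c \<alpha> (circuit_vector F c \<phi> T)"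
proof (rule untwist_inject[where n = n])
  have \<psi>: "transversal_function F n (\<lambda>T. tmult F (Some \<alpha>) (\<phi> T))"
    using \<phi> a tmult_closed[of "Some \<alpha>"] by (auto simp: transversal_function_def simp del: not_None_eq)
  then show "circuit_vector F c (\<lambda>T. tmult F (Some \<alpha>) (\<phi> T)) T \<in> vectors F n"
    using T by (rule circuit_vector_closed)
  show "scale F c \<alpha> (circuit_vector F c \<phi> T) \<in> vectors F n"
    using circuit_vector_closed[OF \<phi> T] a by (rule scale_closed)
  have "\<phi> S \<in> elts F" for S using \<phi> by (simp add: transversal_function_def)
  then show "untwist c (circuit_vector F c (\<lambda>T. tmult F (Some \<alpha>) (\<phi> T)) T) i =
      untwist c (scale F c \<alpha> (circuit_vector F c \<phi> T)) i" for i
    using untwist_scale[OF circuit_vector_closed[OF \<phi> T] a]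
    by (simp add: untwist_circuit_vector[OF \<phi> T] untwist_circuit_vector[OF \<psi> T] alt_sign_scale[OF a])
qed

text \<open>By \<open>circuits_eq\<close> the nonzero circuit vectors have precisely the circuits as
  supports. Orthogonality of their multiples reduces by \<open>inner_product_scale\<close> to the
  Wick relation of the two transversals.\<close>

lemma wick_signature_weak:
  assumes mw: "mw_wick_function F n \<phi>"
  shows "weak_signature_of F c n (bases_of \<phi>) (wick_signature F c n \<phi>)"
proof -
  note mw' = mw[unfolded mw_wick_function_iff]
  interpret M: matroid_bases n "bases_of \<phi>" by unfold_locales (use mw' in simp)
  have \<phi>: "transversal_function F n \<phi>" using mw' by simp
  note cl = circuit_vector_closed[OF \<phi>]
  have "wick_signature F c n \<phi> \<subseteq> vectors F n"
    unfolding wick_signature_def using cl by (auto intro!: scale_closed)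
  moreover have "supp ` wick_signature F c n \<phi> = circuits n (bases_of \<phi>)"
  proof
    show "supp ` wick_signature F c n \<phi> \<subseteq> circuits n (bases_of \<phi>)"
      unfolding wick_signature_def M.circuits_eq by (auto simp: supp_circuit_vector)
    show "circuits n (bases_of \<phi>) \<subseteq> supp ` wick_signature F c n \<phi>"
    proof
      fix C assume "C \<in> circuits n (bases_of \<phi>)"
      then obtain T where T: "T \<in> transversals n" "C = supp (circuit_vector F c \<phi> T)" "C \<noteq> {}"
        unfolding M.circuits_eq supp_circuit_vector by blast
      then have "scale F c \<one> (circuit_vector F c \<phi> T) \<in> wick_signature F c n \<phi>"
        unfolding wick_signature_def by blast
      then show "C \<in> supp ` wick_signature F c n \<phi>" using T(2) by (metis image_eqI supp_scale)
    qed
  qed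
  moreover have "scale F c \<alpha> X \<in> wick_signature F c n \<phi>"
    if X: "X \<in> wick_signature F c n \<phi>" and \<alpha>: "\<alpha> \<in> carrier F" for X \<alpha>
  proof -
    obtain \<beta> T where T: "X = scale F c \<beta> (circuit_vector F c \<phi> T)" "\<beta> \<in> carrier F"
      "T \<in> transversals n" "supp (circuit_vector F c \<phi> T) \<noteq> {}"
      using X unfolding wick_signature_def by blast
    have "scale F c \<alpha> X = scale F c (\<alpha> \<otimes> \<beta>) (circuit_vector F c \<phi> T)"
      unfolding T(1) using scale_scale[OF cl[OF T(3)] \<alpha> T(2)] .
    moreover have "\<alpha> \<otimes> \<beta> \<in> carrier F" using \<alpha> T(2) by simp
    ultimately show ?thesis unfolding wick_signature_def using T(3,4) by blast
  qed
  moreover have "inner_product F c n X (star Y) \<in> null_set F"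
    if XY: "X \<in> wick_signature F c n \<phi>" "Y \<in> wick_signature F c n \<phi>"
      and le: "card (supp X \<inter> uminus ` supp Y) \<le> 4" for X Y
  proof -
    obtain \<alpha> T where T: "X = scale F c \<alpha> (circuit_vector F c \<phi> T)" "\<alpha> \<in> carrier F"
      "T \<in> transversals n"
      using XY(1) unfolding wick_signature_def by blast
    obtain \<beta> S where S: "Y = scale F c \<beta> (circuit_vector F c \<phi> S)" "\<beta> \<in> carrier F"
      "S \<in> transversals n"
      using XY(2) unfolding wick_signature_def by blast
    have "inner_product F c n (circuit_vector F c \<phi> T) (star (circuit_vector F c \<phi> S)) \<in> null_set F"
      using mw' T(3) S(3) le unfolding T(1) S(1) supp_scale by blast
    then show ?thesis
      unfolding T(1) S(1) inner_product_scale[OF cl[OF T(3)] cl[OF S(3)] T(2) S(2)]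
      using T(2) S(2) by (intro null_set_scale) auto
  qed
  ultimately show ?thesis
    unfolding weak_signature_of_def signature_of_def by (intro conjI ballI impI) simp_all
qed

end

section \<open>Weak signatures\<close>

locale weak_signature =
  tract_with_involution F c + matroid_bases n \<B>
  for F (structure) and c :: "'a \<Rightarrow> 'a" and n \<B> +
  fixes \<C> :: "(int \<Rightarrow> 'a option) set"
  assumes weak: "weak_signature_of F c n \<B> \<C>"
begin

lemma signature_vectors: "X \<in> \<C> \<Longrightarrow> X \<in> vectors F n"
  and signature_supp: "supp ` \<C> = circuits n \<B>"
  and signature_scale: "X \<in> \<C> \<Longrightarrow> \<alpha> \<in> carrier F \<Longrightarrow> scale F c \<alpha> X \<in> \<C>"
  and signature_orthogonal: "X \<in> \<C> \<Longrightarrow> Y \<in> \<C> \<Longrightarrow> card (supp X \<inter> uminus ` supp Y) \<le> 4 \<Longrightarrow>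
    inner_product F c n X (star Y) \<in> null_set F"
  using weak by (auto simp: weak_signature_of_def signature_of_def)

lemma untwist_supp:
  assumes "X \<in> \<C>" "x \<in> supp X"
  obtains a where "untwist c X x = Some a" "a \<in> carrier F"
proof -
  have "untwist c X x \<noteq> None" using assms(2) by (simp add: supp_def del: not_None_eq)
  then obtain a where a: "untwist c X x = Some a" by blast
  then have "a \<in> carrier F" using untwist_elts[OF signature_vectors[OF assms(1)], of x] by simp
  with a show ?thesis by (rule that)
qed

text \<open>All terms of the inner product outside \<open>{x, y}\<close> vanish, leaving a
  two-element multiset to which \<open>two_term_null\<close> applies.\<close>

lemma two_term_orthogonality:
  assumes XY: "X \<in> \<C>" "Y \<in> \<C>" and xy: "supp X \<inter> uminus ` supp Y = {x, y}" "x \<noteq> y"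
    and X: "untwist c X x = Some a" "untwist c X y = Some b"
    and Y: "untwist c Y (- x) = Some a'" "untwist c Y (- y) = Some b'"
  shows "b \<otimes> b' = neg_one F \<otimes> (a \<otimes> a')"
proof -
  note v = signature_vectors[OF XY(1)] signature_vectors[OF XY(2)]
  let ?f = "\<lambda>i. formal (tmult F (untwist c X i) (untwist c Y (- i)))"
  have "inner_product F c n X (star Y) = sum ?f (ground n)" using v by (rule inner_product_star)
  also have "\<dots> = sum ?f {x, y}"
  proof (rule sum.mono_neutral_right)
    show "{x, y} \<subseteq> ground n" using xy(1) vectors_supp[OF v(1)] by blast
    show "\<forall>i \<in> ground n - {x, y}. ?f i = {#}"
    proof
      fix i assume "i \<in> ground n - {x, y}"
      then have "i \<notin> supp X \<or> - i \<notin> supp Y" using xy(1) mem_uminus_image[of i "supp Y"] by blast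
      then have "tmult F (untwist c X i) (untwist c Y (- i)) = None"
        unfolding supp_def tmult_eq_None_iff untwist_eq_None_iff by blast
      then show "?f i = {#}" by (simp only: formal.simps)
    qed
  qed simp
  also have "\<dots> = {#a \<otimes> a', b \<otimes> b'#}" using xy(2) X Y by simp
  finally have ip: "inner_product F c n X (star Y) = {#a \<otimes> a', b \<otimes> b'#}" .
  have "inner_product F c n X (star Y) \<in> null_set F"
    using signature_orthogonal[OF XY] xy by (simp add: card_insert_if)
  moreover have "a \<in> carrier F" "b \<in> carrier F" "a' \<in> carrier F" "b' \<in> carrier F"
    using untwist_elts[OF v(1), of x] untwist_elts[OF v(1), of y] untwist_elts[OF v(2), of "- x"]
      untwist_elts[OF v(2), of "- y"] X Y by auto
  ultimately show ?thesis unfolding ip by (intro two_term_null) auto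
qed

lemma fund_circuit_vector:
  assumes "T \<in> transversals n" "fund_circuit \<B> T \<noteq> {}"
  obtains X where "X \<in> \<C>" "supp X = fund_circuit \<B> T"
proof -
  have "fund_circuit \<B> T \<in> supp ` \<C>" unfolding signature_supp circuits_eq using assms by blast
  then show ?thesis using that by force
qed

text \<open>The scalar is read off at a reference element \<open>e\<close> of the circuit. For any
  other element \<open>y\<close>, a vector \<open>Y\<close> supported on the fundamental circuit of
  \<open>flip (flip T e) y\<close> meets both \<open>X\<close> and \<open>X'\<close> only in
  \<open>e\<close> and \<open>y\<close>, so the same relation with two terms fixes the quotient of
  the two coordinates in both vectors.\<close>

lemma same_support_scale:
  assumes XX': "X \<in> \<C>" "X' \<in> \<C>" and eq: "supp X = supp X'"
  obtains \<alpha> where "\<alpha> \<in> carrier F" "X' = scale F c \<alpha> X"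
proof -
  have "supp X \<in> circuits n \<B>" using XX'(1) signature_supp by blast
  then obtain T where T: "T \<in> transversals n" "supp X = fund_circuit \<B> T" "fund_circuit \<B> T \<noteq> {}"
    unfolding circuits_eq by blast
  obtain e where e: "e \<in> fund_circuit \<B> T" using T(3) by blast
  have e': "e \<in> supp X" "e \<in> supp X'" using e T(2) eq by auto
  obtain a where a: "untwist c X e = Some a" "a \<in> carrier F" using untwist_supp[OF XX'(1) e'(1)] .
  obtain a' where a': "untwist c X' e = Some a'" "a' \<in> carrier F" using untwist_supp[OF XX'(2) e'(2)] .
  define \<alpha> where "\<alpha> = a' \<otimes> inv a"
  have \<alpha>: "\<alpha> \<in> carrier F" using a a' by (simp add: \<alpha>_def)
  note v = signature_vectors[OF XX'(1)] signature_vectors[OF XX'(2)]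
  have "X' = scale F c \<alpha> X"
  proof (rule untwist_inject[where n = n])
    fix y
    consider "y \<notin> supp X" | "y = e" | "y \<in> supp X" "y \<noteq> e" by blast
    then show "untwist c X' y = untwist c (scale F c \<alpha> X) y"
    proof cases
      case 1
      then have "X y = None" "X' y = None" using eq unfolding supp_def by blast+
      then have "untwist c X' y = None" "untwist c (scale F c \<alpha> X) y = None"
        by (simp_all add: scale_def)
      then show ?thesis by (simp only:)
    next
      case 2
      then show ?thesis
        using a a' \<alpha> by (simp add: untwist_scale[OF v(1)] \<alpha>_def m_assoc)
    next
      case 3
      then have y: "y \<in> fund_circuit \<B> T" "e \<noteq> y" "y \<in> supp X'" using T(2) eq by auto
      note d = double_flip_fund_circuit[OF T(1) e y(1,2)]
      let ?T' = "flip (flip T e) y"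
      have ne: "fund_circuit \<B> ?T' \<noteq> {}" using d(2) by blast
      obtain Y where Y: "Y \<in> \<C>" "supp Y = fund_circuit \<B> ?T'" using fund_circuit_vector[OF d(1) ne] .
      obtain b where b: "untwist c X y = Some b" "b \<in> carrier F" using untwist_supp[OF XX'(1) 3(1)] .
      obtain b' where b': "untwist c X' y = Some b'" "b' \<in> carrier F" using untwist_supp[OF XX'(2) y(3)] .
      obtain u where u: "untwist c Y (- e) = Some u" "u \<in> carrier F"
        using untwist_supp[OF Y(1), of "- e"] d(2) Y(2) by auto
      obtain v where v: "untwist c Y (- y) = Some v" "v \<in> carrier F"
        using untwist_supp[OF Y(1), of "- y"] d(3) Y(2) by auto
      have s: "supp X \<inter> uminus ` supp Y = {e, y}" "supp X' \<inter> uminus ` supp Y = {e, y}"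
        using d(4) T(2) Y(2) eq by auto
      have 1: "b \<otimes> v = neg_one F \<otimes> (a \<otimes> u)"
        using two_term_orthogonality[OF XX'(1) Y(1) s(1) y(2) a(1) b(1) u(1) v(1)] .
      have 2: "b' \<otimes> v = neg_one F \<otimes> (a' \<otimes> u)"
        using two_term_orthogonality[OF XX'(2) Y(1) s(2) y(2) a'(1) b'(1) u(1) v(1)] .
      have "(\<alpha> \<otimes> b) \<otimes> v = \<alpha> \<otimes> (neg_one F \<otimes> (a \<otimes> u))"
        using 1 \<alpha> b v by (simp add: m_assoc)
      also have "\<dots> = neg_one F \<otimes> ((\<alpha> \<otimes> a) \<otimes> u)" using \<alpha> a u by (simp add: m_ac)
      also have "\<alpha> \<otimes> a = a'" using a a' by (simp add: \<alpha>_def m_assoc)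
      also have "neg_one F \<otimes> (a' \<otimes> u) = b' \<otimes> v" using 2 by simp
      finally have "\<alpha> \<otimes> b = b'" using \<alpha> b b' v by simp
      then show ?thesis using b b' by (simp add: untwist_scale[OF signature_vectors[OF XX'(1)] \<alpha>])
    qed
  qed (use v \<alpha> in \<open>simp_all add: scale_closed\<close>)
  with \<alpha> show ?thesis by (rule that)
qed

end

text \<open>The ranks are 1 and 2 in some order. Their odd sum cancels the factor -1 of a relation
  with two terms in \<open>weight_edge\<close>.\<close>

lemma position_sum_two:
  fixes a b :: int
  assumes "a \<noteq> b"
  shows "card ({a, b} \<inter> {..a}) + card ({a, b} \<inter> {..b}) = 3"
  using assms by (cases "a < b") (auto simp: Int_insert_left)

text \<open>Each of the four elements counts itself, and each of the six pairs contributes one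
  comparison whatever its order.\<close>

lemma position_sum_four:
  fixes a b c d :: int
  assumes "distinct [a, b, c, d]"
  shows "card ({a, b, c, d} \<inter> {..a}) + card ({a, b, c, d} \<inter> {..b}) +
    card ({a, b, c, d} \<inter> {..c}) + card ({a, b, c, d} \<inter> {..d}) = 10"
proof -
  have card: "card ({a, b, c, d} \<inter> {..v}) =
      of_bool (a \<le> v) + of_bool (b \<le> v) + of_bool (c \<le> v) + of_bool (d \<le> v)" for v
    using assms sum_of_bool_eq[of "{a, b, c, d}" "\<lambda>x. x \<le> v", where 'a = nat]
    by (simp add: atMost_def)
  have "of_bool (x \<le> y) + of_bool (y \<le> x) = (1::nat)" if "x \<noteq> y" for x y :: int
    using that by auto
  then have "of_bool (a \<le> b) + of_bool (b \<le> a) = (1::nat)" "of_bool (a \<le> c) + of_bool (c \<le> a) = (1::nat)"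
    "of_bool (a \<le> d) + of_bool (d \<le> a) = (1::nat)" "of_bool (b \<le> c) + of_bool (c \<le> b) = (1::nat)"
    "of_bool (b \<le> d) + of_bool (d \<le> b) = (1::nat)" "of_bool (c \<le> d) + of_bool (d \<le> c) = (1::nat)"
    using assms by (simp_all del: of_bool_eq_1_iff)
  moreover have refl: "of_bool (x \<le> x) = (1::nat)" for x :: int by simp
  ultimately show ?thesis unfolding card refl by linarith
qed

section \<open>Weights, ratios and reconstruction of a Wick function\<close>

context weak_signature
begin

text \<open>For nonempty fundamental circuits the choice is free up to a scalar by
  \<open>same_support_scale\<close>; quotients of coordinates do not depend on it.\<close>

definition fund_vector :: "int set \<Rightarrow> int \<Rightarrow> 'a option" where
  "fund_vector T = (SOME X. X \<in> \<C> \<and> supp X = fund_circuit \<B> T)"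

text \<open>
  The weights of \<open>T\<close> are the values, up to a scalar depending on \<open>T\<close>, that the Wick function
  has to take at the bases \<open>flip T x\<close>.
\<close>

definition weight :: "int set \<Rightarrow> int \<Rightarrow> 'a" where
  "weight T x = the (alt_sign F (card (T \<inter> {1..\<bar>x\<bar>})) (untwist c (fund_vector T) x))"

lemma fund_vector:
  assumes "T \<in> transversals n" "fund_circuit \<B> T \<noteq> {}"
  shows "fund_vector T \<in> \<C>" "supp (fund_vector T) = fund_circuit \<B> T"
proof -
  have "\<exists>X. X \<in> \<C> \<and> supp X = fund_circuit \<B> T" using fund_circuit_vector[OF assms] by blast
  from someI_ex[OF this]
  show "fund_vector T \<in> \<C>" "supp (fund_vector T) = fund_circuit \<B> T"
    unfolding fund_vector_def by blast+
qed

lemma neg_one_cancel: "a \<in> carrier F \<Longrightarrow> neg_one F \<otimes> (neg_one F \<otimes> a) = a"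
  by (simp add: m_assoc[symmetric] neg_one_square)

lemma weight:
  assumes T: "T \<in> transversals n" and x: "x \<in> fund_circuit \<B> T"
  shows "weight T x \<in> carrier F"
    and "untwist c (fund_vector T) x = Some (neg_one F [^] card (T \<inter> {1..\<bar>x\<bar>}) \<otimes> weight T x)"
proof -
  have ne: "fund_circuit \<B> T \<noteq> {}" using x by blast
  note X = fund_vector[OF T ne]
  obtain a where a: "untwist c (fund_vector T) x = Some a" "a \<in> carrier F"
    using untwist_supp[OF X(1), of x] X(2) x by auto
  then have w: "weight T x = neg_one F [^] card (T \<inter> {1..\<bar>x\<bar>}) \<otimes> a"
    by (simp add: weight_def alt_sign_Some)
  show "weight T x \<in> carrier F" using w a by simp
  show "untwist c (fund_vector T) x = Some (neg_one F [^] card (T \<inter> {1..\<bar>x\<bar>}) \<otimes> weight T x)"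
    using a by (simp add: w neg_one_pow neg_one_cancel)
qed

lemma quotient_of_products:
  assumes abpqs: "a \<in> carrier F" "b \<in> carrier F" "p \<in> carrier F" "q \<in> carrier F" "s \<in> carrier F"
    and eq: "a \<otimes> b = s \<otimes> (p \<otimes> q)"
  shows "b \<otimes> inv q = s \<otimes> (p \<otimes> inv a)"
proof -
  have "b = inv a \<otimes> (s \<otimes> (p \<otimes> q))" using abpqs eq by (metis inv_solve_left m_closed)
  then have "b = (s \<otimes> (p \<otimes> inv a)) \<otimes> q" using abpqs by (simp add: m_ac)
  then show ?thesis using abpqs by (metis inv_closed inv_solve_right m_closed)
qed

text \<open>Powers of -1 are their own inverses and depend only on parity, so all signs can be
  gathered on one side. The successor in the exponent is the factor -1 of the relation
  itself.\<close>

lemma sign_transfer: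
  assumes abcd: "a \<in> carrier F" "b \<in> carrier F" "p \<in> carrier F" "q \<in> carrier F"
    and eq: "(neg_one F [^] (k::nat) \<otimes> a) \<otimes> (neg_one F [^] (l::nat) \<otimes> b) =
      neg_one F \<otimes> ((neg_one F [^] (i::nat) \<otimes> p) \<otimes> (neg_one F [^] (j::nat) \<otimes> q))"
    and parity: "even (k + l) \<longleftrightarrow> even s" "even (i + j) \<longleftrightarrow> even t"
  shows "a \<otimes> b = neg_one F [^] (Suc (t + s)) \<otimes> (p \<otimes> q)"
proof -
  have pow: "neg_one F [^] (k + l) = neg_one F [^] s" "neg_one F [^] (i + j) = neg_one F [^] t"
    using parity by (simp_all add: neg_one_pow)
  have cancel: "neg_one F [^] s \<otimes> (neg_one F [^] s \<otimes> g) = g" if "g \<in> carrier F" for g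
    using that by (simp add: neg_one_pow neg_one_cancel)
  have "neg_one F [^] s \<otimes> (a \<otimes> b) = (neg_one F [^] k \<otimes> a) \<otimes> (neg_one F [^] l \<otimes> b)"
    using abcd by (simp add: pow(1)[symmetric] nat_pow_mult[symmetric] m_ac)
  also have "\<dots> = neg_one F \<otimes> (neg_one F [^] t \<otimes> (p \<otimes> q))"
    unfolding eq using abcd by (simp add: pow(2)[symmetric] nat_pow_mult[symmetric] m_ac)
  finally have "a \<otimes> b = neg_one F [^] s \<otimes> (neg_one F \<otimes> (neg_one F [^] t \<otimes> (p \<otimes> q)))"
    using cancel[of "a \<otimes> b"] abcd by simp
  then show ?thesis using abcd by (simp add: nat_pow_mult[symmetric] m_ac)
qed

text \<open>This is \<open>two_term_orthogonality\<close> for the chosen vectors. Replacing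
  coordinates by weights turns the position signs, modulo two, into ranks in the symmetric
  difference.\<close>

lemma weight_two_term:
  assumes T: "T\<^sub>1 \<in> transversals n" "T\<^sub>2 \<in> transversals n"
    and xy: "fund_circuit \<B> T\<^sub>1 \<inter> uminus ` fund_circuit \<B> T\<^sub>2 = {x, y}" "x \<noteq> y"
  shows "weight T\<^sub>1 y \<otimes> weight T\<^sub>2 (- y) =
    neg_one F [^] (Suc (card (sym_diff T\<^sub>1 T\<^sub>2 \<inter> {1..\<bar>x\<bar>}) + card (sym_diff T\<^sub>1 T\<^sub>2 \<inter> {1..\<bar>y\<bar>})))
      \<otimes> (weight T\<^sub>1 x \<otimes> weight T\<^sub>2 (- x))"
proof -
  have m: "x \<in> fund_circuit \<B> T\<^sub>1" "y \<in> fund_circuit \<B> T\<^sub>1" using xy(1) by blast+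
  have "x \<in> uminus ` fund_circuit \<B> T\<^sub>2" "y \<in> uminus ` fund_circuit \<B> T\<^sub>2" using xy(1) by blast+
  then have m': "- x \<in> fund_circuit \<B> T\<^sub>2" "- y \<in> fund_circuit \<B> T\<^sub>2"
    unfolding mem_uminus_image by blast+
  have ne: "fund_circuit \<B> T\<^sub>1 \<noteq> {}" "fund_circuit \<B> T\<^sub>2 \<noteq> {}" using m m' by blast+
  note X = fund_vector[OF T(1) ne(1)] and Y = fund_vector[OF T(2) ne(2)]
  note w = weight[OF T(1) m(1)] weight[OF T(1) m(2)] weight[OF T(2) m'(1)] weight[OF T(2) m'(2)]
  have s: "supp (fund_vector T\<^sub>1) \<inter> uminus ` supp (fund_vector T\<^sub>2) = {x, y}"
    using xy(1) X(2) Y(2) by simp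
  have "(neg_one F [^] card (T\<^sub>1 \<inter> {1..\<bar>y\<bar>}) \<otimes> weight T\<^sub>1 y) \<otimes>
      (neg_one F [^] card (T\<^sub>2 \<inter> {1..\<bar>- y\<bar>}) \<otimes> weight T\<^sub>2 (- y)) =
    neg_one F \<otimes> ((neg_one F [^] card (T\<^sub>1 \<inter> {1..\<bar>x\<bar>}) \<otimes> weight T\<^sub>1 x) \<otimes>
      (neg_one F [^] card (T\<^sub>2 \<inter> {1..\<bar>- x\<bar>}) \<otimes> weight T\<^sub>2 (- x)))"
    using two_term_orthogonality[OF X(1) Y(1) s xy(2) w(2) w(4) w(6) w(8)] .
  then show ?thesis
    by (rule sign_transfer[OF w(3,7,1,5)])
      (use even_card_position[OF T, of "\<bar>x\<bar>"] even_card_position[OF T, of "\<bar>y\<bar>"] in simp_all)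
qed

lemma sym_diff_position:
  assumes "sym_diff T\<^sub>1 T\<^sub>2 = S \<union> uminus ` S" "0 \<notin> S"
  shows "sym_diff T\<^sub>1 T\<^sub>2 \<inter> {1..\<bar>v\<bar>} = abs ` S \<inter> {..\<bar>v::int\<bar>}"
proof -
  have "x \<in> S \<union> uminus ` S \<and> 1 \<le> x \<longleftrightarrow> x \<in> abs ` S" for x :: int
  proof
    assume "x \<in> S \<union> uminus ` S \<and> 1 \<le> x"
    then obtain y where "y \<in> S" "x = \<bar>y\<bar>" by fastforce
    then show "x \<in> abs ` S" by blast
  next
    assume "x \<in> abs ` S"
    then obtain y where y: "y \<in> S" "x = \<bar>y\<bar>" by blast
    then have "y \<noteq> 0" using assms(2) by metis
    with y show "x \<in> S \<union> uminus ` S \<and> 1 \<le> x" by (auto simp: mem_uminus_image abs_if)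
  qed
  then show ?thesis unfolding assms(1) by (auto simp: Set.set_eq_iff)
qed

text \<open>The total exponent is 1 + 1 + 2 = 4, so the sign disappears. Hence \<open>T\<close> and
  its double flip assign the same quotient to the two bases that they share.\<close>

lemma weight_edge:
  assumes T: "T \<in> transversals n" and xy: "x \<in> fund_circuit \<B> T" "y \<in> fund_circuit \<B> T" "x \<noteq> y"
  shows "weight T y \<otimes> weight (flip (flip T x) y) (- y) = weight T x \<otimes> weight (flip (flip T x) y) (- x)"
proof -
  let ?T' = "flip (flip T x) y"
  note d = double_flip_fund_circuit[OF T xy]
  have m: "x \<in> T" "y \<in> T" using xy fund_circuit_subset by blast+
  then have n: "- x \<notin> T" "- y \<notin> T" using transversal_uminus[OF T] by blast+
  then have z: "0 \<notin> {x, y}" using m by auto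
  have "sym_diff T ?T' = {x, y} \<union> uminus ` {x, y}"
    using m n xy(3) by (auto simp: flip_iff split: if_splits)
  then have s: "sym_diff T ?T' \<inter> {1..\<bar>v\<bar>} = {\<bar>x\<bar>, \<bar>y\<bar>} \<inter> {..\<bar>v\<bar>}" for v
    using sym_diff_position[OF _ z, of T ?T' v] by simp
  have "\<bar>x\<bar> \<noteq> \<bar>y\<bar>" using xy(3) m n by (auto simp: abs_eq_iff)
  from position_sum_two[OF this]
  have "weight T y \<otimes> weight ?T' (- y) = neg_one F [^] (4::nat) \<otimes> (weight T x \<otimes> weight ?T' (- x))"
    using weight_two_term[OF T d(1) d(4) xy(3)] unfolding s by simp
  then show ?thesis
    using weight(1)[OF T xy(1)] weight(1)[OF d(1,2)] by (simp add: neg_one_pow)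
qed

text \<open>The prescribed value of the Wick function at \<open>B'\<close> divided by that at
  \<open>B\<close>. Two distinct bases may be seen from two different transversals, hence the
  choice, justified by \<open>weight_ratio_unique\<close>.\<close>

definition ratio :: "int set \<Rightarrow> int set \<Rightarrow> 'a" where
  "ratio B B' = (SOME g. \<exists>T x y. T \<in> transversals n \<and> x \<in> fund_circuit \<B> T \<and> y \<in> fund_circuit \<B> T \<and>
     B = flip T x \<and> B' = flip T y \<and> g = weight T y \<otimes> inv (weight T x))"

text \<open>A transversal one flip away from two distinct bases \<open>flip T x\<close> and
  \<open>flip T y\<close> is either \<open>T\<close> or its double flip at \<open>x\<close> and
  \<open>y\<close>; the second case is \<open>weight_edge\<close>. For equal bases both quotients
  are 1.\<close>

lemma weight_ratio_unique:
  assumes T: "T \<in> transversals n" "x \<in> fund_circuit \<B> T" "y \<in> fund_circuit \<B> T"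
    and T': "T' \<in> transversals n" "x' \<in> fund_circuit \<B> T'" "y' \<in> fund_circuit \<B> T'"
    and eq: "flip T x = flip T' x'" "flip T y = flip T' y'"
  shows "weight T y \<otimes> inv (weight T x) = weight T' y' \<otimes> inv (weight T' x')"
proof -
  have m: "x \<in> T" "y \<in> T" "x' \<in> T'" "y' \<in> T'" using T T' fund_circuit_subset by blast+
  then have n: "- x \<notin> T" "- y \<notin> T" "- x' \<notin> T'" "- y' \<notin> T'"
    using transversal_uminus[OF T(1)] transversal_uminus[OF T'(1)] by blast+
  note w = weight(1)[OF T(1,2)] weight(1)[OF T(1,3)] weight(1)[OF T'(1,2)] weight(1)[OF T'(1,3)]
  have T'_eq: "T' = flip (flip T x) x'" using eq(1) by simp
  show ?thesis
  proof (cases "x = y")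
    case True
    then have "flip T' x' = flip T' y'" using eq by metis
    then have "x' = y'" using m n by auto
    then show ?thesis using True w by simp
  next
    case False
    have "flip T x \<noteq> flip T y" using False m n by auto
    then have "flip T' x' \<noteq> flip T' y'" using eq by simp
    then have ny: "x' \<noteq> y'" "x' \<noteq> - y'" by auto
    \<comment> \<open>At any other place the two bases agree with \<open>T\<close>, whereas the
      flips of \<open>T'\<close> at \<open>x'\<close> and at \<open>y'\<close> differ from each
      other there.\<close>
    have "x' = x \<or> x' = - x \<or> x' = y \<or> x' = - y"
    proof (rule ccontr)
      assume "\<not> ?thesis"
      then have "x' \<in> T' \<longleftrightarrow> x' \<notin> T" and "x' \<in> flip T y \<longleftrightarrow> x' \<in> T"
        unfolding T'_eq by (auto simp: flip_iff)
      moreover have "x' \<in> flip T' y' \<longleftrightarrow> x' \<in> T'" using ny by (simp add: flip_iff)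
      ultimately show False using eq(2) by simp
    qed
    then consider "x' = x \<or> x' = - x" | "x' = y \<or> x' = - y" by blast
    then show ?thesis
    proof cases
      case 1
      then have "T' = T" using T'_eq by auto
      then have "x' = x" "y' = y" using 1 m n eq by auto
      then show ?thesis using \<open>T' = T\<close> by simp
    next
      case 2
      then have T'': "T' = flip (flip T x) y" using T'_eq by auto
      note d = double_flip_fund_circuit[OF T False]
      have d': "- x \<in> T'" "- y \<in> T'" using d(2,3) fund_circuit_subset T'' by blast+
      then have x': "x' = - y" using 2 n m by auto
      have "flip T' x = flip T y" unfolding T'' by (subst flip_commute) simp
      then have "y' = x \<or> y' = - x" using eq(2) by (metis flip_eq_iff minus_minus)
      then have y': "y' = - x" using d' n m by auto
      have "weight T y \<otimes> weight T' x' = weight T x \<otimes> weight T' y'"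
        using weight_edge[OF T False] unfolding x' y' T'' .
      then have "weight T' x' \<otimes> weight T y = \<one> \<otimes> (weight T' y' \<otimes> weight T x)"
        using w by (simp add: m_comm)
      then have "weight T y \<otimes> inv (weight T x) = \<one> \<otimes> (weight T' y' \<otimes> inv (weight T' x'))"
        using w by (intro quotient_of_products) simp_all
      then show ?thesis using w by simp
    qed
  qed
qed

lemma ratio_flip:
  assumes T: "T \<in> transversals n" "x \<in> fund_circuit \<B> T" "y \<in> fund_circuit \<B> T"
  shows "ratio (flip T x) (flip T y) = weight T y \<otimes> inv (weight T x)"
proof -
  let ?P = "\<lambda>g. \<exists>S u v. S \<in> transversals n \<and> u \<in> fund_circuit \<B> S \<and> v \<in> fund_circuit \<B> S \<and>
     flip T x = flip S u \<and> flip T y = flip S v \<and> g = weight S v \<otimes> inv (weight S u)"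
  have "?P (weight T y \<otimes> inv (weight T x))"
    by (intro exI[of _ T] exI[of _ x] exI[of _ y]) (simp add: T)
  then have "?P (ratio (flip T x) (flip T y))" unfolding ratio_def by (rule someI)
  then show ?thesis using weight_ratio_unique[OF T] by metis
qed

text \<open>The two transversals used, \<open>flip B x\<close> and
  \<open>flip (flip (flip B z) w) y\<close>, carry opposite edges of the square and differ in four
  pairs. The missing diagonals remove the terms at \<open>z\<close> and \<open>w\<close>, and the
  remaining two terms compare the ratios along these edges.\<close>

lemma ratio_half_square:
  assumes B: "B \<in> \<B>" "{x, y, z, w} \<subseteq> B" "distinct [x, y, z, w]"
    and D: "flip (flip B x) y \<in> \<B>" "flip (flip B z) w \<in> \<B>" "flip (flip (flip (flip B x) y) z) w \<in> \<B>"
    and nb: "flip (flip B x) z \<notin> \<B>" "flip (flip B x) w \<notin> \<B>"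
  shows "ratio (flip (flip (flip (flip B x) y) z) w) (flip (flip B z) w) =
    neg_one F [^] (Suc (card ({\<bar>x\<bar>, \<bar>y\<bar>, \<bar>z\<bar>, \<bar>w\<bar>} \<inter> {..\<bar>x\<bar>}) + card ({\<bar>x\<bar>, \<bar>y\<bar>, \<bar>z\<bar>, \<bar>w\<bar>} \<inter> {..\<bar>y\<bar>})))
      \<otimes> ratio (flip (flip B x) y) B"
    and "ratio (flip (flip B x) y) B \<in> carrier F"
proof -
  note tB = basis_transversal[OF B(1)]
  let ?D = "flip (flip (flip (flip B x) y) z) w"
  let ?T1 = "flip B x" and ?T2 = "flip (flip (flip B z) w) y"
  have m: "x \<in> B" "y \<in> B" "z \<in> B" "w \<in> B" using B(2) by auto
  then have n: "- x \<notin> B" "- y \<notin> B" "- z \<notin> B" "- w \<notin> B"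
    using transversal_uminus[OF tB] by blast+
  have nz: "x \<noteq> 0" "y \<noteq> 0" "z \<noteq> 0" "w \<noteq> 0" using m n by auto
  have ne: "x \<noteq> y" "x \<noteq> z" "x \<noteq> w" "y \<noteq> z" "y \<noteq> w" "z \<noteq> w" using B(3) by auto
  have ne': "x \<noteq> - y" "x \<noteq> - z" "x \<noteq> - w" "y \<noteq> - z" "y \<noteq> - w" "z \<noteq> - w"
    "y \<noteq> - x" "z \<noteq> - x" "w \<noteq> - x" "z \<noteq> - y" "w \<noteq> - y" "w \<noteq> - z" using m n by auto
  have g: "x \<in> ground n" "y \<in> ground n" "z \<in> ground n" "w \<in> ground n"
    using m transversal_subset_ground[OF tB] by auto
  have T: "?T1 \<in> transversals n" "?T2 \<in> transversals n" using tB g by (simp_all add: transversal_flip)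
  have f2: "flip ?T2 y = flip (flip B z) w" "flip ?T2 x = ?D"
    by (simp_all add: flip_commute)
  have mT1: "- x \<in> ?T1" "y \<in> ?T1" and mT2: "x \<in> ?T2" "- y \<in> ?T2"
    using m n ne ne' by (auto simp: flip_iff)
  have c1: "- x \<in> fund_circuit \<B> ?T1" "y \<in> fund_circuit \<B> ?T1"
    using mT1 B D by (auto simp: fund_circuit_def)
  have c2: "x \<in> fund_circuit \<B> ?T2" "- y \<in> fund_circuit \<B> ?T2"
    using mT2 D f2 by (auto simp: fund_circuit_def)
  have d: "?T1 - ?T2 = {- x, y, z, w}"
    using m n ne ne' by (auto simp: flip_iff split: if_splits)
  have int: "fund_circuit \<B> ?T1 \<inter> uminus ` fund_circuit \<B> ?T2 = {- x, y}"
    unfolding fund_circuit_Int[OF T] d using nb B D f2 by auto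
  have "sym_diff ?T1 ?T2 = {x, y, z, w} \<union> uminus ` {x, y, z, w}"
    using m n ne ne' by (auto simp: flip_iff split: if_splits)
  then have s: "sym_diff ?T1 ?T2 \<inter> {1..\<bar>v\<bar>} = {\<bar>x\<bar>, \<bar>y\<bar>, \<bar>z\<bar>, \<bar>w\<bar>} \<inter> {..\<bar>v\<bar>}" for v
    using sym_diff_position[of ?T1 ?T2 "{x, y, z, w}" v] nz by simp
  have r1: "ratio (flip (flip B x) y) B = weight ?T1 (- x) \<otimes> inv (weight ?T1 y)"
    using ratio_flip[OF T(1) c1(2,1)] by simp
  have r2: "ratio ?D (flip (flip B z) w) = weight ?T2 (- y) \<otimes> inv (weight ?T2 x)"
    using ratio_flip[OF T(2) c2] f2 by simp
  note w = weight(1)[OF T(1) c1(1)] weight(1)[OF T(1) c1(2)] weight(1)[OF T(2) c2(1)]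
    weight(1)[OF T(2) c2(2)]
  show "ratio (flip (flip B x) y) B \<in> carrier F" using r1 w by simp
  let ?s = "neg_one F [^] (Suc (card ({\<bar>x\<bar>, \<bar>y\<bar>, \<bar>z\<bar>, \<bar>w\<bar>} \<inter> {..\<bar>x\<bar>}) +
      card ({\<bar>x\<bar>, \<bar>y\<bar>, \<bar>z\<bar>, \<bar>w\<bar>} \<inter> {..\<bar>y\<bar>})))"
  have "- x \<noteq> y" using ne' by auto
  then have "weight ?T1 y \<otimes> weight ?T2 (- y) = ?s \<otimes> (weight ?T1 (- x) \<otimes> weight ?T2 x)"
    using weight_two_term[OF T int] unfolding s by simp
  then show "ratio ?D (flip (flip B z) w) = ?s \<otimes> ratio (flip (flip B x) y) B"
    unfolding r1 r2 using w by (intro quotient_of_products) simp_all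
qed

lemma ratio_square:
  assumes B: "B \<in> \<B>" "{x, y, z, w} \<subseteq> B" "distinct [x, y, z, w]"
    and D: "flip (flip B x) y \<in> \<B>" "flip (flip B z) w \<in> \<B>" "flip (flip (flip (flip B x) y) z) w \<in> \<B>"
    and nb: "flip (flip B x) z \<notin> \<B>" "flip (flip B x) w \<notin> \<B>"
      "flip (flip B y) z \<notin> \<B>" "flip (flip B y) w \<notin> \<B>"
  shows "ratio (flip (flip (flip (flip B x) y) z) w) (flip (flip B x) y) \<otimes> ratio (flip (flip B x) y) B =
    ratio (flip (flip (flip (flip B x) y) z) w) (flip (flip B z) w) \<otimes> ratio (flip (flip B z) w) B"
proof -
  let ?D1 = "flip (flip B x) y" and ?D2 = "flip (flip B z) w"
  have D_eq: "flip (flip ?D2 x) y = flip (flip ?D1 z) w"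
    by (simp add: flip_commute)
  have nb': "flip (flip B z) x \<notin> \<B>" "flip (flip B z) y \<notin> \<B>"
    using nb by (simp_all add: flip_commute[of B z])
  \<comment> \<open>Each pair of opposite edges has equal ratios up to a sign; the two signs agree because
    the positions of \<open>x, y, z, w\<close> add up to \<open>1 + 2 + 3 + 4\<close>.\<close>
  let ?S = "{\<bar>x\<bar>, \<bar>y\<bar>, \<bar>z\<bar>, \<bar>w\<bar>}"
  let ?p = "\<lambda>v. card (?S \<inter> {..\<bar>v\<bar>})"
  have perm: "{\<bar>z\<bar>, \<bar>w\<bar>, \<bar>x\<bar>, \<bar>y\<bar>} = ?S" by blast
  note h1 = ratio_half_square[OF B D nb(1,2)]
  have h2: "ratio (flip (flip ?D1 z) w) ?D1 = neg_one F [^] (Suc (?p z + ?p w)) \<otimes> ratio ?D2 B"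
    "ratio ?D2 B \<in> carrier F"
    using ratio_half_square[of B z w x y] B D nb' unfolding D_eq perm by auto
  have n: "\<And>v. v \<in> B \<Longrightarrow> - v \<notin> B" using transversal_uminus[OF basis_transversal[OF B(1)]] by blast
  have "distinct [\<bar>x\<bar>, \<bar>y\<bar>, \<bar>z\<bar>, \<bar>w\<bar>]" using B(2,3) n by (auto simp: abs_eq_iff)
  then have "?p x + ?p y + ?p z + ?p w = 10" by (rule position_sum_four)
  then have "even (?p x + ?p y) \<longleftrightarrow> even (?p z + ?p w)" by presburger
  then have "neg_one F [^] (Suc (?p z + ?p w)) = neg_one F [^] (Suc (?p x + ?p y))"
    unfolding neg_one_pow by simp
  then show ?thesis unfolding h1(1) h2(1) using h1(2) h2(2) by (simp add: m_ac del: nat_pow_Suc)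
qed

text \<open>A potential of \<open>ratio\<close> is proportional to the weights on each clique, so
  every nonzero circuit vector of the resulting function is a multiple of the chosen vector of the
  signature. Both the Wick relations and the equality of signatures follow.\<close>

lemma wick_function_exists:
  obtains \<phi> where "mw_wick_function F n \<phi>" "wick_signature F c n \<phi> = \<C>"
proof -
  have adj: "\<exists>x \<in> fund_circuit \<B> T. B = flip T x" if "B \<in> adjacent_bases \<B> T" for B T
    using that by (auto simp: adjacent_bases_def)
  obtain f where f: "\<And>B. B \<in> \<B> \<Longrightarrow> f B \<in> carrier F"
    and fr: "\<And>T B B'. T \<in> transversals n \<Longrightarrow> B \<in> adjacent_bases \<B> T \<Longrightarrow>
      B' \<in> adjacent_bases \<B> T \<Longrightarrow> f B' = f B \<otimes> ratio B B'"
  proof (rule potential[of F ratio])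
    show "comm_group F" by (rule comm_group_axioms)
    show "ratio B B' \<in> carrier F"
      if T: "T \<in> transversals n" and BB: "B \<in> adjacent_bases \<B> T" "B' \<in> adjacent_bases \<B> T" for T B B'
    proof -
      obtain x y where "x \<in> fund_circuit \<B> T" "y \<in> fund_circuit \<B> T" "B = flip T x" "B' = flip T y"
        using adj[OF BB(1)] adj[OF BB(2)] by blast
      then show ?thesis using ratio_flip[OF T] weight(1)[OF T] by simp
    qed
    show "ratio B B' \<otimes> ratio B' B'' = ratio B B''"
      if T: "T \<in> transversals n" and BB: "B \<in> adjacent_bases \<B> T" "B' \<in> adjacent_bases \<B> T"
        "B'' \<in> adjacent_bases \<B> T" for T B B' B''
    proof -
      obtain x y z where xyz: "x \<in> fund_circuit \<B> T" "y \<in> fund_circuit \<B> T" "z \<in> fund_circuit \<B> T"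
        "B = flip T x" "B' = flip T y" "B'' = flip T z"
        using adj[OF BB(1)] adj[OF BB(2)] adj[OF BB(3)] by blast
      note w = weight(1)[OF T xyz(1)] weight(1)[OF T xyz(2)] weight(1)[OF T xyz(3)]
      have swap: "(p \<otimes> q) \<otimes> (s \<otimes> t) = (s \<otimes> q) \<otimes> (p \<otimes> t)"
        if "p \<in> carrier F" "q \<in> carrier F" "s \<in> carrier F" "t \<in> carrier F" for p q s t
        using that by (simp add: m_ac)
      have "weight T y \<otimes> inv (weight T x) \<otimes> (weight T z \<otimes> inv (weight T y)) =
          weight T z \<otimes> inv (weight T x)"
        using w by (subst swap) simp_all
      then show ?thesis using xyz ratio_flip[OF T] by simp
    qed
  qed (rule ratio_square, assumption+, blast)
  define \<phi> where "\<phi> B = (if B \<in> \<B> then Some (f B) else None)" for B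
  have \<phi>: "transversal_function F n \<phi>"
    unfolding transversal_function_def \<phi>_def using f basis_transversal by auto
  have bases: "bases_of \<phi> = \<B>" by (auto simp: bases_of_def \<phi>_def)
  have cv: "circuit_vector F c \<phi> T \<in> \<C>" if T: "T \<in> transversals n" "fund_circuit \<B> T \<noteq> {}" for T
  proof -
    obtain e where e: "e \<in> fund_circuit \<B> T" using T(2) by blast
    note X = fund_vector[OF T]
    note v = signature_vectors[OF X(1)] and cl = circuit_vector_closed[OF \<phi> T(1)]
    have fb: "f (flip T x) \<in> carrier F" if "x \<in> fund_circuit \<B> T" for x
      using that f by (simp add: fund_circuit_def)
    \<comment> \<open>The factor between \<open>f\<close> and the weights of \<open>T\<close>,
      measured at the reference element \<open>e\<close>; \<open>fw\<close> shows that it is the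
      same at all other elements.\<close>
    define \<alpha> where "\<alpha> = f (flip T e) \<otimes> inv (weight T e)"
    have \<alpha>: "\<alpha> \<in> carrier F" using fb[OF e] weight(1)[OF T(1) e] by (simp add: \<alpha>_def)
    have fw: "f (flip T x) = \<alpha> \<otimes> weight T x" if x: "x \<in> fund_circuit \<B> T" for x
    proof -
      have "f (flip T x) = f (flip T e) \<otimes> (weight T x \<otimes> inv (weight T e))"
        using fr[OF T(1) imageI[OF e, of "flip T", folded adjacent_bases_def]
            imageI[OF x, of "flip T", folded adjacent_bases_def]] ratio_flip[OF T(1) e x]
        by simp
      then show ?thesis
        using fb[OF e] weight(1)[OF T(1) e] weight(1)[OF T(1) x] by (simp add: \<alpha>_def m_ac)
    qed
    have "circuit_vector F c \<phi> T = scale F c \<alpha> (fund_vector T)"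
    proof (rule untwist_inject[where n = n])
      fix x
      show "untwist c (circuit_vector F c \<phi> T) x = untwist c (scale F c \<alpha> (fund_vector T)) x"
      proof (cases "x \<in> fund_circuit \<B> T")
        case True
        then have "x \<in> T" "flip T x \<in> \<B>" by (auto simp: fund_circuit_def)
        then show ?thesis
          using weight[OF T(1) True] \<alpha> fw[OF True]
          by (simp add: untwist_circuit_vector[OF \<phi> T(1)] untwist_scale[OF v \<alpha>] \<phi>_def alt_sign_Some m_ac)
      next
        case False
        have "supp (circuit_vector F c \<phi> T) = fund_circuit \<B> T" by (simp add: supp_circuit_vector bases)
        then have "circuit_vector F c \<phi> T x = None" "scale F c \<alpha> (fund_vector T) x = None"
          using False X(2) supp_scale[of F c \<alpha> "fund_vector T"] unfolding supp_def by blast+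
        then show ?thesis by (simp add: untwist_def)
      qed
    qed (use cl v \<alpha> in \<open>simp_all add: scale_closed\<close>)
    then show ?thesis using signature_scale[OF X(1) \<alpha>] by simp
  qed
  have "mw_wick_function F n \<phi>"
    unfolding mw_wick_function_iff bases
  proof (intro conjI ballI impI)
    fix T\<^sub>1 T\<^sub>2
    assume T: "T\<^sub>1 \<in> transversals n" "T\<^sub>2 \<in> transversals n"
      and le: "card (supp (circuit_vector F c \<phi> T\<^sub>1) \<inter> uminus ` supp (circuit_vector F c \<phi> T\<^sub>2)) \<le> 4"
    show "inner_product F c n (circuit_vector F c \<phi> T\<^sub>1) (star (circuit_vector F c \<phi> T\<^sub>2)) \<in> null_set F"
    \<comment> \<open>A transversal with no basis one flip away has a zero circuit vector, which is
      not in the signature; its inner products are the empty sum, null by definition of a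
      tract.\<close>
    proof (cases "fund_circuit \<B> T\<^sub>1 = {} \<or> fund_circuit \<B> T\<^sub>2 = {}")
      case True
      then show ?thesis
        using inner_product_zero[OF circuit_vector_closed[OF \<phi> T(1)] circuit_vector_closed[OF \<phi> T(2)]]
          zero_null by (simp add: supp_circuit_vector bases)
    next
      case False
      then show ?thesis using signature_orthogonal[OF cv[OF T(1)] cv[OF T(2)] le] by blast
    qed
  qed (fact \<phi> matroid)+
  moreover have "wick_signature F c n \<phi> = \<C>"
  proof
    show "wick_signature F c n \<phi> \<subseteq> \<C>"
      unfolding wick_signature_def using cv signature_scale
      by (auto simp: supp_circuit_vector bases)
    show "\<C> \<subseteq> wick_signature F c n \<phi>"
    proof
      fix X assume X: "X \<in> \<C>"
      then have "supp X \<in> circuits n \<B>" using signature_supp by blast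
      then obtain T where T: "T \<in> transversals n" "supp X = fund_circuit \<B> T" "fund_circuit \<B> T \<noteq> {}"
        unfolding circuits_eq by blast
      have s: "supp (circuit_vector F c \<phi> T) = fund_circuit \<B> T" by (simp add: supp_circuit_vector bases)
      obtain \<alpha> where "\<alpha> \<in> carrier F" "X = scale F c \<alpha> (circuit_vector F c \<phi> T)"
        using same_support_scale[OF cv[OF T(1,3)] X] s T(2) by metis
      then show "X \<in> wick_signature F c n \<phi>" unfolding wick_signature_def using T s by auto
    qed
  qed
  ultimately show ?thesis by (rule that)
qed

end

text \<open>Equal signatures give equal bases and, on each clique, proportional values. Cliques
  sharing a basis must have the same scalar, because the value there is a unit, and the bases are
  connected.\<close>

lemma (in tract_with_involution) wick_signature_inject:
  assumes mw: "mw_wick_function F n \<phi>" "mw_wick_function F n \<psi>"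
    and eq: "wick_signature F c n \<phi> = wick_signature F c n \<psi>"
  obtains \<alpha> where "\<alpha> \<in> carrier F" "\<psi> = (\<lambda>T. tmult F (Some \<alpha>) (\<phi> T))"
proof -
  note mw' = mw[unfolded mw_wick_function_iff]
  have tf: "transversal_function F n \<phi>" "transversal_function F n \<psi>"
    and om: "orthogonal_matroid n (bases_of \<phi>)" "orthogonal_matroid n (bases_of \<psi>)"
    using mw' by simp_all
  note w = wick_signature_weak[OF mw(1)] wick_signature_weak[OF mw(2), folded eq]
  have "circuits n (bases_of \<phi>) = circuits n (bases_of \<psi>)"
    using w unfolding weak_signature_of_def signature_of_def by metis
  then have bases: "bases_of \<psi> = bases_of \<phi>" using circuits_inject[OF om] by simp
  interpret W: weak_signature F c n "bases_of \<phi>" "wick_signature F c n \<phi>"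
    by unfold_locales (use om w in auto)
  have in_sig: "circuit_vector F c \<chi> T \<in> wick_signature F c n \<chi>"
    if "transversal_function F n \<chi>" "T \<in> transversals n" "supp (circuit_vector F c \<chi> T) \<noteq> {}" for \<chi> T
  proof -
    have "circuit_vector F c \<chi> T = scale F c \<one> (circuit_vector F c \<chi> T)"
      using scale_one[OF circuit_vector_closed[OF that(1,2)]] by simp
    then show ?thesis unfolding wick_signature_def using that by blast
  qed
  have val: "\<exists>a \<in> carrier F. \<chi> B = Some a" if \<chi>: "transversal_function F n \<chi>" "B \<in> bases_of \<chi>" for \<chi> B
  proof -
    obtain a where a: "\<chi> B = Some a" using \<chi>(2) by (auto simp: bases_of_def)
    then show ?thesis using \<chi>(1) Some_in_elts[of a F] by (metis transversal_function_def)
  qed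
  \<comment> \<open>Both circuit vectors at \<open>T\<close> lie in the common signature with the
    same support, so \<open>same_support_scale\<close> applies; the position signs then cancel in
    each coordinate.\<close>
  have local: "\<exists>\<alpha> \<in> carrier F. \<forall>B \<in> adjacent_bases (bases_of \<phi>) T. \<psi> B = tmult F (Some \<alpha>) (\<phi> B)"
    if T: "T \<in> transversals n" "adjacent_bases (bases_of \<phi>) T \<noteq> {}" for T
  proof -
    have s: "supp (circuit_vector F c \<phi> T) = fund_circuit (bases_of \<phi>) T"
      "supp (circuit_vector F c \<psi> T) = fund_circuit (bases_of \<phi>) T"
      using bases by (simp_all add: supp_circuit_vector)
    have ne: "fund_circuit (bases_of \<phi>) T \<noteq> {}" using T(2) by (simp add: adjacent_bases_def)
    have "circuit_vector F c \<phi> T \<in> wick_signature F c n \<phi>"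
      "circuit_vector F c \<psi> T \<in> wick_signature F c n \<phi>"
      using in_sig[OF tf(1) T(1)] in_sig[OF tf(2) T(1)] s ne eq by simp_all
    then obtain \<alpha> where \<alpha>: "\<alpha> \<in> carrier F"
      "circuit_vector F c \<psi> T = scale F c \<alpha> (circuit_vector F c \<phi> T)"
      using W.same_support_scale s by metis
    have "\<psi> (flip T x) = tmult F (Some \<alpha>) (\<phi> (flip T x))" if x: "x \<in> fund_circuit (bases_of \<phi>) T" for x
    proof -
      have x': "x \<in> T" "flip T x \<in> bases_of \<phi>" "flip T x \<in> bases_of \<psi>"
        using x bases by (auto simp: fund_circuit_def)
      obtain a b where ab: "\<phi> (flip T x) = Some a" "a \<in> carrier F" "\<psi> (flip T x) = Some b" "b \<in> carrier F"
        using val[OF tf(1) x'(2)] val[OF tf(2) x'(3)] by blast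
      have "untwist c (circuit_vector F c \<psi> T) x =
          tmult F (Some \<alpha>) (untwist c (circuit_vector F c \<phi> T) x)"
        unfolding \<alpha>(2) by (rule untwist_scale[OF circuit_vector_closed[OF tf(1) T(1)] \<alpha>(1)])
      then have "neg_one F [^] card (T \<inter> {1..\<bar>x\<bar>}) \<otimes> b = \<alpha> \<otimes> (neg_one F [^] card (T \<inter> {1..\<bar>x\<bar>}) \<otimes> a)"
        using x' ab by (simp add: untwist_circuit_vector[OF tf(1) T(1)]
            untwist_circuit_vector[OF tf(2) T(1)] alt_sign_Some)
      also have "\<dots> = neg_one F [^] card (T \<inter> {1..\<bar>x\<bar>}) \<otimes> (\<alpha> \<otimes> a)"
        using ab \<alpha>(1) by (simp add: m_lcomm)
      finally have "b = \<alpha> \<otimes> a" using ab \<alpha>(1) by simp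
      then show ?thesis using ab by simp
    qed
    then show ?thesis using \<alpha>(1) by (auto simp: adjacent_bases_def)
  qed
  obtain B\<^sub>0 where B0: "B\<^sub>0 \<in> bases_of \<phi>" using W.bases_nonempty by blast
  obtain a b where ab: "\<phi> B\<^sub>0 = Some a" "a \<in> carrier F" "\<psi> B\<^sub>0 = Some b" "b \<in> carrier F"
    using val[OF tf(1) B0] val[OF tf(2)] B0 bases by metis
  define \<alpha> where "\<alpha> = b \<otimes> inv a"
  have \<alpha>: "\<alpha> \<in> carrier F" using ab by (simp add: \<alpha>_def)
  have "\<psi> B = tmult F (Some \<alpha>) (\<phi> B)" if "B \<in> bases_of \<phi>" for B
  proof (rule W.bases_connected[OF B0 that, where P = "\<lambda>B. \<psi> B = tmult F (Some \<alpha>) (\<phi> B)"])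
    show "\<psi> B\<^sub>0 = tmult F (Some \<alpha>) (\<phi> B\<^sub>0)" using ab by (simp add: \<alpha>_def m_assoc)
    fix T B B'
    assume T: "T \<in> transversals n"
      and adj: "B \<in> adjacent_bases (bases_of \<phi>) T" "B' \<in> adjacent_bases (bases_of \<phi>) T"
      and B: "\<psi> B = tmult F (Some \<alpha>) (\<phi> B)"
    obtain \<beta> where \<beta>: "\<beta> \<in> carrier F" "\<psi> B = tmult F (Some \<beta>) (\<phi> B)" "\<psi> B' = tmult F (Some \<beta>) (\<phi> B')"
      using local[OF T] adj by blast
    have "B \<in> bases_of \<phi>" using adj(1) W.adjacent_bases_subset by blast
    then obtain p where p: "p \<in> carrier F" "\<phi> B = Some p" using val[OF tf(1)] by blast
    have "\<alpha> = \<beta>" using B \<beta>(1,2) p \<alpha> by simp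
    then show "\<psi> B' = tmult F (Some \<alpha>) (\<phi> B')" using \<beta>(3) by simp
  qed
  moreover have "\<psi> B = tmult F (Some \<alpha>) (\<phi> B)" if "B \<notin> bases_of \<phi>" for B
  proof -
    have "\<phi> B = None" "\<psi> B = None" using that bases unfolding bases_of_def by blast+
    then show ?thesis by simp
  qed
  ultimately have "\<psi> = (\<lambda>T. tmult F (Some \<alpha>) (\<phi> T))" by blast
  with \<alpha> show ?thesis by (rule that)
qed

lemma (in tract_with_involution) wick_signature_scale:
  assumes \<phi>: "transversal_function F n \<phi>" and a: "\<alpha> \<in> carrier F"
  shows "wick_signature F c n (\<lambda>T. tmult F (Some \<alpha>) (\<phi> T)) = wick_signature F c n \<phi>"
proof
  let ?\<psi> = "\<lambda>T. tmult F (Some \<alpha>) (\<phi> T)"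
  note cv = circuit_vector_scale[OF \<phi> a] and cl = circuit_vector_closed[OF \<phi>]
  show "wick_signature F c n ?\<psi> \<subseteq> wick_signature F c n \<phi>"
  proof
    fix X assume "X \<in> wick_signature F c n ?\<psi>"
    then obtain \<beta> T where X: "X = scale F c \<beta> (circuit_vector F c ?\<psi> T)" "\<beta> \<in> carrier F"
      "T \<in> transversals n" "supp (circuit_vector F c ?\<psi> T) \<noteq> {}"
      unfolding wick_signature_def by blast
    have "X = scale F c (\<beta> \<otimes> \<alpha>) (circuit_vector F c \<phi> T)"
      unfolding X(1) cv[OF X(3)] by (rule scale_scale[OF cl[OF X(3)] X(2) a])
    moreover have "supp (circuit_vector F c \<phi> T) \<noteq> {}" using X(4) unfolding cv[OF X(3)] by simp
    moreover have "\<beta> \<otimes> \<alpha> \<in> carrier F" using X(2) a by simp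
    ultimately show "X \<in> wick_signature F c n \<phi>" unfolding wick_signature_def using X(3) by blast
  qed
  show "wick_signature F c n \<phi> \<subseteq> wick_signature F c n ?\<psi>"
  proof
    fix X assume "X \<in> wick_signature F c n \<phi>"
    then obtain \<beta> T where X: "X = scale F c \<beta> (circuit_vector F c \<phi> T)" "\<beta> \<in> carrier F"
      "T \<in> transversals n" "supp (circuit_vector F c \<phi> T) \<noteq> {}"
      unfolding wick_signature_def by blast
    have b: "\<beta> \<otimes> inv \<alpha> \<in> carrier F" using X(2) a by simp
    have "scale F c (\<beta> \<otimes> inv \<alpha>) (circuit_vector F c ?\<psi> T) =
        scale F c (\<beta> \<otimes> inv \<alpha> \<otimes> \<alpha>) (circuit_vector F c \<phi> T)"
      unfolding cv[OF X(3)] by (rule scale_scale[OF cl[OF X(3)] b a])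
    also have "\<dots> = X" using X(1,2) a by (simp add: m_assoc)
    finally have "X = scale F c (\<beta> \<otimes> inv \<alpha>) (circuit_vector F c ?\<psi> T)" by simp
    moreover have "supp (circuit_vector F c ?\<psi> T) \<noteq> {}" using X(4) unfolding cv[OF X(3)] by simp
    ultimately show "X \<in> wick_signature F c n ?\<psi>" unfolding wick_signature_def using X(3) b by blast
  qed
qed

text \<open>Among Wick functions the equivalence is the kernel of \<open>wick_signature\<close>,
  which yields both well-definedness and injectivity on classes.\<close>

lemma (in tract_with_involution) wick_equiv_iff:
  assumes mw: "mw_wick_function F n \<phi>" "mw_wick_function F n \<psi>"
  shows "(\<phi>, \<psi>) \<in> wick_equiv F n \<longleftrightarrow> wick_signature F c n \<phi> = wick_signature F c n \<psi>"
proof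
  assume "(\<phi>, \<psi>) \<in> wick_equiv F n"
  then obtain \<alpha> where "\<alpha> \<in> carrier F" "\<psi> = (\<lambda>T. tmult F (Some \<alpha>) (\<phi> T))"
    by (auto simp: wick_equiv_def)
  then show "wick_signature F c n \<phi> = wick_signature F c n \<psi>"
    using wick_signature_scale mw(1) by (simp add: mw_wick_function_iff)
next
  assume "wick_signature F c n \<phi> = wick_signature F c n \<psi>"
  then obtain \<alpha> where "\<alpha> \<in> carrier F" "\<psi> = (\<lambda>T. tmult F (Some \<alpha>) (\<phi> T))"
    using wick_signature_inject[OF mw] by blast
  then show "(\<phi>, \<psi>) \<in> wick_equiv F n" using mw by (auto simp: wick_equiv_def)
qed

section \<open>The bijection induced on equivalence classes\<close>

theorem theorem1p4:
  fixes F :: "('a, 'm) tract_scheme" and c :: "'a \<Rightarrow> 'a" and n :: nat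
  assumes "tract F" and "tract_involution F c"
  shows "\<exists>\<Phi>. bij_betw \<Phi> (mw_orthogonal_matroids F n) (weak_orthogonal_signatures F c n) \<and>
             (\<forall>\<phi>. mw_wick_function F n \<phi> \<longrightarrow>
                 \<Phi> (wick_equiv F n `` {\<phi>}) = wick_signature F c n \<phi>)"
proof -
  interpret tract F by fact
  interpret tract_with_involution F c by unfold_locales fact
  let ?M = "{\<phi>. mw_wick_function F n \<phi>}" and ?R = "wick_equiv F n"
  \<comment> \<open>A class is sent to the signature of an arbitrary representative; by
    \<open>R_iff\<close> all representatives give the same one.\<close>
  let ?\<Phi> = "\<lambda>K. wick_signature F c n (SOME \<phi>. \<phi> \<in> K)"
  have R_iff: "(\<phi>, \<psi>) \<in> ?R \<longleftrightarrow> mw_wick_function F n \<phi> \<and> mw_wick_function F n \<psi> \<and>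
      wick_signature F c n \<phi> = wick_signature F c n \<psi>" for \<phi> \<psi>
  proof -
    have "(\<phi>, \<psi>) \<in> ?R \<Longrightarrow> mw_wick_function F n \<phi> \<and> mw_wick_function F n \<psi>"
      by (auto simp: wick_equiv_def)
    then show ?thesis using wick_equiv_iff[of n \<phi> \<psi>] by blast
  qed
  have \<Phi>: "?\<Phi> (?R `` {\<phi>}) = wick_signature F c n \<phi>" if "mw_wick_function F n \<phi>" for \<phi>
  proof -
    have same: "wick_signature F c n \<psi> = wick_signature F c n \<phi>" if "\<psi> \<in> ?R `` {\<phi>}" for \<psi>
      using that by (simp add: R_iff)
    have "\<phi> \<in> ?R `` {\<phi>}" using that by (simp add: R_iff)
    then have "(SOME \<psi>. \<psi> \<in> ?R `` {\<phi>}) \<in> ?R `` {\<phi>}"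
      by (rule someI[where P = "\<lambda>\<psi>. \<psi> \<in> ?R `` {\<phi>}"])
    then show ?thesis by (rule same)
  qed
  have "inj_on ?\<Phi> (?M // ?R)"
  proof (rule inj_onI)
    fix K L assume K: "K \<in> ?M // ?R" and L: "L \<in> ?M // ?R" and eq: "?\<Phi> K = ?\<Phi> L"
    obtain \<phi> where \<phi>: "K = ?R `` {\<phi>}" "mw_wick_function F n \<phi>" using K by (auto elim: quotientE)
    obtain \<psi> where \<psi>: "L = ?R `` {\<psi>}" "mw_wick_function F n \<psi>" using L by (auto elim: quotientE)
    have "wick_signature F c n \<phi> = wick_signature F c n \<psi>"
      using eq \<Phi>[OF \<phi>(2)] \<Phi>[OF \<psi>(2)] \<phi>(1) \<psi>(1) by simp
    then show "K = L" unfolding \<phi>(1) \<psi>(1) using \<phi>(2) \<psi>(2) by (auto simp: R_iff)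
  qed
  moreover have "?\<Phi> ` (?M // ?R) = weak_orthogonal_signatures F c n"
  proof (intro equalityI subsetI)
    fix \<C> assume "\<C> \<in> ?\<Phi> ` (?M // ?R)"
    then obtain K where K: "K \<in> ?M // ?R" "\<C> = ?\<Phi> K" by blast
    then obtain \<phi> where \<phi>: "K = ?R `` {\<phi>}" "mw_wick_function F n \<phi>" by (auto elim: quotientE)
    then have "\<C> = wick_signature F c n \<phi>" using \<Phi> K(2) by simp
    moreover have "orthogonal_matroid n (bases_of \<phi>)" using \<phi>(2) by (simp add: mw_wick_function_iff)
    ultimately show "\<C> \<in> weak_orthogonal_signatures F c n"
      unfolding weak_orthogonal_signatures_def using wick_signature_weak[OF \<phi>(2)] by blast
  next
    fix \<C> assume "\<C> \<in> weak_orthogonal_signatures F c n"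
    then obtain \<B> where \<B>: "orthogonal_matroid n \<B>" "weak_signature_of F c n \<B> \<C>"
      unfolding weak_orthogonal_signatures_def by blast
    interpret weak_signature F c n \<B> \<C> by unfold_locales (use \<B> in auto)
    obtain \<phi> where \<phi>: "mw_wick_function F n \<phi>" "wick_signature F c n \<phi> = \<C>"
      by (rule wick_function_exists)
    have "?R `` {\<phi>} \<in> ?M // ?R" using \<phi>(1) by (auto intro: quotientI)
    moreover have "\<C> = ?\<Phi> (?R `` {\<phi>})" using \<Phi>[OF \<phi>(1)] \<phi>(2) by simp
    ultimately show "\<C> \<in> ?\<Phi> ` (?M // ?R)" by (rule rev_image_eqI)
  qed
  ultimately have "bij_betw ?\<Phi> (mw_orthogonal_matroids F n) (weak_orthogonal_signatures F c n)"
    by (simp add: bij_betw_def mw_orthogonal_matroids_def)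
  with \<Phi> show ?thesis by blast
qed

end
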